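(* Consider the droop-controlled microgrid $$0=P_i^*-P_{\mathrm e,i}(\theta),\ i\in\mathcal V_L,\qquad D_i\dot\theta_i=P_i^*-P_{\mathrm e,i}(\theta)+u_i(t),\ i\in\mathcal V_I,$$ with $P_i^*\in[0,\overline P_i]$ and $D_i>0$ for $i\in\mathcal V_I$. Assume a complete communication topology among the inverters $\mathcal V_I$, and let $u_i(t)$ be given by the centralized averaging PI (CAPI) controller $u_i=-p_i$, $k_i\dot p_i=\sum_{j\in\mathcal V_I}D_j\dot\theta_j/\sum_{j\in\mathcal V_I}D_j$ with the parametric choice $k_i=k/D_i$, $k>0$, so that the closed loop is $$\begin{aligned}0&=P_i^*-P_{\mathrm e,i}(\theta),&& i\in\mathcal V_L,\\ D_i\dot\theta_i&=P_i^*-P_{\mathrm e,i}(\theta)-p_i,&& i\in\mathcal V_I,\\ k\,\frac{\dot p_i}{D_i}&=\frac{\sum_{j\in\mathcal V_I}D_j\dot\theta_j}{\sum_{j\in\mathcal V_I}D_j},&& i\in\mathcal V_I.\end{aligned}$$ Let $\omega_{\rm sync}=\sum_{i\in\mathcal V}P_i^*/\sum_{i\in\mathcal V_I}D_i$, let $\widetilde P_i=P_i^*$ for $i\in\mathcal V_L$ and $\widetilde P_i=P_i^*-D_i\omega_{\rm sync}$ for $i\in\mathcal V_I$, and let $\xi=B^\dagger\widetilde P$. The following two statements are equivalent: (i) (stability of primary droop control) $\|\mathcal A^{-1}\xi\|_\infty<1$; (ii) (stability of CAPI control) there exists an arc length $\gamma\in[0,\pi/2)$ such that the closed loop above possesses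 a locally exponentially stable and unique equilibrium manifold $([\theta^*],p^* )\subset\overline\Delta_G(\gamma)\times\mathbb R^{n_I}$. If the equivalent statements (i) and (ii) are true, then $[\theta^*]$ and all injections are those of the equilibrium manifold in $\overline\Delta_G(\gamma)$ of the shifted system ($0=\widetilde P_i-P_{\mathrm e,i}(\theta)$ for $i\in\mathcal V_L$, $D_i\dot\theta_i=\widetilde P_i-P_{\mathrm e,i}(\theta)$ for $i\in\mathcal V_I$), that is, $\boldsymbol{\sin}(B^T\theta^* )=\mathcal A^{-1}\xi$ and $P_{\mathrm e}(\theta^* )=\widetilde P$; and $p_i^*=D_i\,\omega_{\rm sync}$ for $i\in\mathcal V_I$.
   Context: Network: $G(\mathcal V,\mathcal E)$ is a connected, undirected, acyclic graph with node set $\mathcal V=\{1,\dots,n\}$ partitioned into loads and inverters, $\mathcal V=\mathcal V_L\cup\mathcal V_I$, $n_I=|\mathcal V_I|$. $B\in\mathbb R^{n\times|\mathcal E|}$ is its oriented incidence matrix (arbitrary orientation), and $B^\dagger=(B^TB)^{-1}B^T$. All lines are purely inductive: $\mathfrak{Im}(Y_{ij})=1/|z_{ij}|>0$ for $\{i,j\}\in\mathcal E$, where $z_{ij}$ is the line impedance, and $Y_{ij}=0$ for $i\neq j$, $\{i,j\}\notin\mathcal E$. Voltage magnitudes $E_i>0$ are constant. $\theta\in\mathbb T^n$ is the vector of phase angles, and the active power injections are $P_{\mathrm e,i}(\theta)=\sum_{j=1}^n\mathfrak{Im}(Y_{ij})E_iE_j\sin(\theta_i-\theta_j)$. Let $\mathcal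 A=\mathrm{diag}(\{\mathfrak{Im}(Y_{ij})E_iE_j\}_{\{i,j\}\in\mathcal E})$; $\boldsymbol{\sin}$ acts componentwise. $P_i^*\in\mathbb R$ is the constant injection of load $i\in\mathcal V_L$. For $i\in\mathcal V_I$, $\overline P_i\ge0$ is the inverter rating and $P_i^*$ its nominal injection setpoint. Throughout, $0\le-\sum_{i\in\mathcal V_L}P_i^*\le\sum_{i\in\mathcal V_I}\overline P_i$. $\overline\Delta_G(\gamma)=\{\theta\in\mathbb T^n:\max_{\{i,j\}\in\mathcal E}|\theta_i-\theta_j|\le\gamma\}$, where $|\theta_i-\theta_j|$ is the geodesic distance on the circle. $[\theta]$ denotes the orbit of $\theta\in\mathbb T^n$ under simultaneous rotation of all angles by the same angle. Equilibria come in such orbits (equilibrium manifolds), and uniqueness and stability are understood modulo this rotational symmetry.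
   Formalization: Uniqueness and stability in (ii) are taken among controller states with all p_i/D_i equal (e.g. p(0)=0): the differences p_i/D_i − p_j/D_j are conserved, so for two or more inverters (i)⇒(ii) fails for arbitrary p in R^{n_I}. *)

theory Defs
  imports "HOL-Analysis.Analysis"
begin

section \<open>Graph\<close>

text \<open>
  Nodes are the elements of a finite type. The edges, together with the arbitrary orientation used
  for the incidence matrix, are given by a set \<open>E\<close> of ordered pairs that contains each undirected
  edge in exactly one of its two orientations (\<open>asym E\<close>).
\<close>

definition adjacent :: "('n \<times> 'n) set \<Rightarrow> 'n \<Rightarrow> 'n \<Rightarrow> bool" where
  "adjacent E i j \<longleftrightarrow> (i, j) \<in> E \<or> (j, i) \<in> E"

definition connected_graph :: "('n \<times> 'n) set \<Rightarrow> bool" where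
  "connected_graph E \<longleftrightarrow> (\<forall>i j. (adjacent E)\<^sup>*\<^sup>* i j)"

definition undirected_cycle :: "('n \<times> 'n) set \<Rightarrow> 'n list \<Rightarrow> bool" where
  "undirected_cycle E c \<longleftrightarrow> 3 \<le> length c \<and> distinct c \<and>
     (\<forall>l < length c. adjacent E (c ! l) (c ! (Suc l mod length c)))"

definition acyclic_graph :: "('n \<times> 'n) set \<Rightarrow> bool" where
  "acyclic_graph E \<longleftrightarrow> \<not> (\<exists>c. undirected_cycle E c)"

section \<open>Edge space, incidence matrix and its pseudoinverse\<close>

text \<open>
  Edge vectors and matrices are indexed by all ordered pairs; the space \<open>\<real>\<^sup>|\<^sup>E\<^sup>|\<close> is
  the subspace of the vectors supported on \<open>E\<close>. Entries outside \<open>E\<close> are zero, so that matrix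
  products agree with those of the matrices indexed by \<open>E\<close>. Inverses of \<open>E \<times> E\<close> matrices have to
  be taken on this subspace. The empty edge set (a single node) is covered.
\<close>

definition edge_space :: "('n \<times> 'n) set \<Rightarrow> (real ^ ('n::finite \<times> 'n)) set" where
  "edge_space E = {x. \<forall>e. e \<notin> E \<longrightarrow> x $ e = 0}"

definition edge_inv ::
  "('n \<times> 'n) set \<Rightarrow> real ^ ('n \<times> 'n) ^ ('n \<times> 'n) \<Rightarrow> real ^ ('n \<times> 'n) \<Rightarrow> real ^ ('n::finite \<times> 'n)" where
  "edge_inv E M = inv_into (edge_space E) (\<lambda>x. M *v x)"

definition incidence :: "('n \<times> 'n) set \<Rightarrow> real ^ ('n \<times> 'n) ^ ('n::finite)" where
  "incidence E = (\<chi> i e. if e \<in> E then (if i = fst e then 1 else if i = snd e then -1 else 0) else 0)"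

definition incidence_pinv :: "('n \<times> 'n) set \<Rightarrow> real ^ 'n \<Rightarrow> real ^ ('n::finite \<times> 'n)" where
  "incidence_pinv E x =
     edge_inv E (transpose (incidence E) ** incidence E) (transpose (incidence E) *v x)"

definition weight_matrix ::
  "('n \<times> 'n) set \<Rightarrow> complex ^ 'n ^ 'n \<Rightarrow> ('n \<Rightarrow> real) \<Rightarrow> real ^ ('n \<times> 'n) ^ ('n::finite \<times> 'n)" where
  "weight_matrix E Y V =
     (\<chi> e f. if e = f \<and> e \<in> E then Im (Y $ fst e $ snd e) * V (fst e) * V (snd e) else 0)"

definition vec_sin :: "real ^ 'e \<Rightarrow> real ^ 'e" where
  "vec_sin x = (\<chi> e. sin (x $ e))"

section \<open>Angles\<close>

text \<open>
  A point of the torus is represented by any of its lifts to \<open>\<real>\<^sup>n\<close>; accordingly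
  \<open>orbit \<theta>\<close> is the full preimage of the rotation orbit, and the Euclidean distance to
  \<open>orbit \<theta>\<close> is the geodesic distance on the torus to the rotation orbit.
\<close>

definition circle_dist :: "real \<Rightarrow> real \<Rightarrow> real" where
  "circle_dist x y = (INF m::int. \<bar>x - y + 2 * pi * of_int m\<bar>)"

definition arc_set :: "('n \<times> 'n) set \<Rightarrow> real \<Rightarrow> (real ^ 'n) set" where
  "arc_set E \<gamma> = {\<theta>. \<forall>(i, j) \<in> E. circle_dist (\<theta> $ i) (\<theta> $ j) \<le> \<gamma>}"

definition orbit :: "real ^ 'n \<Rightarrow> (real ^ 'n) set" where
  "orbit \<theta> = {\<phi>. \<exists>(c::real) (m::'n \<Rightarrow> int). \<forall>i. \<phi> $ i = \<theta> $ i + c + 2 * pi * of_int (m i)}"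

section \<open>Power flow and droop control\<close>

definition P_e :: "complex ^ 'n ^ 'n \<Rightarrow> ('n \<Rightarrow> real) \<Rightarrow> real ^ 'n \<Rightarrow> real ^ ('n::finite)" where
  "P_e Y V \<theta> = (\<chi> i. \<Sum>j\<in>UNIV. Im (Y $ i $ j) * V i * V j * sin (\<theta> $ i - \<theta> $ j))"

text \<open>
  The differential-algebraic equations relate an angle vector \<open>\<theta>\<close> and its velocity \<open>d\<theta>\<close>;
  \<open>P\<close> are the injections and setpoints, \<open>u\<close> is the secondary control input.
\<close>

definition droop_eqs ::
  "'n set \<Rightarrow> 'n set \<Rightarrow> complex ^ 'n ^ 'n \<Rightarrow> ('n \<Rightarrow> real) \<Rightarrow> ('n \<Rightarrow> real) \<Rightarrow> real ^ 'n \<Rightarrow> real ^ 'n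
    \<Rightarrow> real ^ 'n \<Rightarrow> real ^ ('n::finite) \<Rightarrow> bool" where
  "droop_eqs V\<^sub>L V\<^sub>I Y V D P u \<theta> d\<theta> \<longleftrightarrow>
     (\<forall>i\<in>V\<^sub>L. 0 = P $ i - P_e Y V \<theta> $ i) \<and>
     (\<forall>i\<in>V\<^sub>I. D i * d\<theta> $ i = P $ i - P_e Y V \<theta> $ i + u $ i)"

definition droop_equilibrium ::
  "'n set \<Rightarrow> 'n set \<Rightarrow> complex ^ 'n ^ 'n \<Rightarrow> ('n \<Rightarrow> real) \<Rightarrow> ('n \<Rightarrow> real) \<Rightarrow> real ^ 'n
    \<Rightarrow> real ^ ('n::finite) \<Rightarrow> bool" where
  "droop_equilibrium V\<^sub>L V\<^sub>I Y V D P \<theta> \<longleftrightarrow> droop_eqs V\<^sub>L V\<^sub>I Y V D P 0 \<theta> 0"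

definition \<omega>_sync :: "'n set \<Rightarrow> ('n \<Rightarrow> real) \<Rightarrow> real ^ ('n::finite) \<Rightarrow> real" where
  "\<omega>_sync V\<^sub>I D P = (\<Sum>i\<in>UNIV. P $ i) / (\<Sum>i\<in>V\<^sub>I. D i)"

definition P_shift :: "'n set \<Rightarrow> ('n \<Rightarrow> real) \<Rightarrow> real ^ 'n \<Rightarrow> real ^ ('n::finite)" where
  "P_shift V\<^sub>I D P = (\<chi> i. if i \<in> V\<^sub>I then P $ i - D i * \<omega>_sync V\<^sub>I D P else P $ i)"

section \<open>CAPI control\<close>

definition CAPI_eqs ::
  "'n set \<Rightarrow> ('n \<Rightarrow> real) \<Rightarrow> ('n \<Rightarrow> real) \<Rightarrow> real ^ 'n \<Rightarrow> real ^ ('n::finite) \<Rightarrow> bool" where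
  "CAPI_eqs V\<^sub>I D \<kappa> d\<theta> dp \<longleftrightarrow>
     (\<forall>i\<in>V\<^sub>I. \<kappa> i * dp $ i = (\<Sum>j\<in>V\<^sub>I. D j * d\<theta> $ j) / (\<Sum>j\<in>V\<^sub>I. D j))"

definition closed_loop_eqs ::
  "'n set \<Rightarrow> 'n set \<Rightarrow> complex ^ 'n ^ 'n \<Rightarrow> ('n \<Rightarrow> real) \<Rightarrow> ('n \<Rightarrow> real) \<Rightarrow> real \<Rightarrow> real ^ 'n
    \<Rightarrow> real ^ 'n \<Rightarrow> real ^ 'n \<Rightarrow> real ^ 'n \<Rightarrow> real ^ ('n::finite) \<Rightarrow> bool" where
  "closed_loop_eqs V\<^sub>L V\<^sub>I Y V D k P \<theta> p d\<theta> dp \<longleftrightarrow>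
     droop_eqs V\<^sub>L V\<^sub>I Y V D P (- p) \<theta> d\<theta> \<and> CAPI_eqs V\<^sub>I D (\<lambda>i. k / D i) d\<theta> dp"

text \<open>The space of the controller states, one real number per inverter.\<close>

definition inverter_space :: "'n set \<Rightarrow> (real ^ 'n) set" where
  "inverter_space V\<^sub>I = {p. \<forall>i. i \<notin> V\<^sub>I \<longrightarrow> p $ i = 0}"

text \<open>
  Along solutions of the closed loop all differences \<open>p\<^sub>i / D\<^sub>i - p\<^sub>j / D\<^sub>j\<close> are constant: the
  integrators have the same input and differ only by their initial values. For more than one
  inverter, equilibria with different values of these constants form continua, so that no
  equilibrium manifold could be exponentially stable under perturbations that change them.
  Stability and uniqueness therefore refer to consistently initialised integrators (for instance
  \<open>p(0) = 0\<close>), that is, to the following invariant subspace.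
\<close>

definition CAPI_space :: "'n set \<Rightarrow> ('n \<Rightarrow> real) \<Rightarrow> (real ^ 'n) set" where
  "CAPI_space V\<^sub>I D = {p \<in> inverter_space V\<^sub>I. \<forall>i\<in>V\<^sub>I. \<forall>j\<in>V\<^sub>I. p $ i / D i = p $ j / D j}"

definition closed_loop_solutions ::
  "'n set \<Rightarrow> 'n set \<Rightarrow> complex ^ 'n ^ 'n \<Rightarrow> ('n \<Rightarrow> real) \<Rightarrow> ('n \<Rightarrow> real) \<Rightarrow> real \<Rightarrow> real ^ 'n
    \<Rightarrow> (real \<Rightarrow> (real ^ 'n) \<times> (real ^ ('n::finite))) set" where
  "closed_loop_solutions V\<^sub>L V\<^sub>I Y V D k P =
     {x. \<exists>d\<theta> dp. \<forall>t\<ge>0.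
           snd (x t) \<in> inverter_space V\<^sub>I \<and>
           (x has_vector_derivative (d\<theta> t, dp t)) (at t within {0..}) \<and>
           closed_loop_eqs V\<^sub>L V\<^sub>I Y V D k P (fst (x t)) (snd (x t)) (d\<theta> t) (dp t)}"

text \<open>Initial states that satisfy the algebraic load equations.\<close>

definition closed_loop_initial_states ::
  "'n set \<Rightarrow> 'n set \<Rightarrow> complex ^ 'n ^ 'n \<Rightarrow> ('n \<Rightarrow> real) \<Rightarrow> ('n \<Rightarrow> real) \<Rightarrow> real ^ 'n
    \<Rightarrow> ((real ^ 'n) \<times> (real ^ ('n::finite))) set" where
  "closed_loop_initial_states V\<^sub>L V\<^sub>I Y V D P =
     {\<theta>. \<forall>i\<in>V\<^sub>L. 0 = P $ i - P_e Y V \<theta> $ i} \<times> CAPI_space V\<^sub>I D"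

definition closed_loop_equilibrium ::
  "'n set \<Rightarrow> 'n set \<Rightarrow> complex ^ 'n ^ 'n \<Rightarrow> ('n \<Rightarrow> real) \<Rightarrow> ('n \<Rightarrow> real) \<Rightarrow> real \<Rightarrow> real ^ 'n
    \<Rightarrow> real ^ 'n \<Rightarrow> real ^ ('n::finite) \<Rightarrow> bool" where
  "closed_loop_equilibrium V\<^sub>L V\<^sub>I Y V D k P \<theta> p \<longleftrightarrow>
     p \<in> CAPI_space V\<^sub>I D \<and> closed_loop_eqs V\<^sub>L V\<^sub>I Y V D k P \<theta> p 0 0"

text \<open>
  Local exponential stability of a set \<open>M\<close> for the initial states \<open>X\<close> and the solutions \<open>S\<close>.
  Global existence of the solutions starting near \<open>M\<close> is part of the definition, since it is not
  automatic for differential-algebraic equations.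
\<close>

definition locally_exponentially_stable ::
  "'s::metric_space set \<Rightarrow> (real \<Rightarrow> 's) set \<Rightarrow> 's set \<Rightarrow> bool" where
  "locally_exponentially_stable X S M \<longleftrightarrow>
     (\<exists>\<delta>>0. \<exists>C>0. \<exists>r>0. \<forall>x0\<in>X. infdist x0 M < \<delta> \<longrightarrow>
        (\<exists>x\<in>S. x 0 = x0) \<and>
        (\<forall>x\<in>S. x 0 = x0 \<longrightarrow> (\<forall>t\<ge>0. infdist (x t) M \<le> C * exp (- r * t) * infdist x0 M)))"

definition stable_unique_equilibrium_manifold ::
  "('n \<times> 'n) set \<Rightarrow> 'n set \<Rightarrow> 'n set \<Rightarrow> complex ^ 'n ^ 'n \<Rightarrow> ('n \<Rightarrow> real) \<Rightarrow> ('n \<Rightarrow> real) \<Rightarrow> real \<Rightarrow> real ^ 'n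
    \<Rightarrow> real \<Rightarrow> real ^ 'n \<Rightarrow> real ^ ('n::finite) \<Rightarrow> bool" where
  "stable_unique_equilibrium_manifold E V\<^sub>L V\<^sub>I Y V D k P \<gamma> \<theta> p \<longleftrightarrow>
     \<theta> \<in> arc_set E \<gamma> \<and> closed_loop_equilibrium V\<^sub>L V\<^sub>I Y V D k P \<theta> p \<and>
     (\<forall>\<phi> q. \<phi> \<in> arc_set E \<gamma> \<and> closed_loop_equilibrium V\<^sub>L V\<^sub>I Y V D k P \<phi> q
        \<longrightarrow> \<phi> \<in> orbit \<theta> \<and> q = p) \<and>
     locally_exponentially_stable (closed_loop_initial_states V\<^sub>L V\<^sub>I Y V D P)
       (closed_loop_solutions V\<^sub>L V\<^sub>I Y V D k P) (orbit \<theta> \<times> {p})"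

end

(*
The CAPI integrators reduce to a scalar q = p_i / D_i with k q' = omega_sync - q, and q - omega_sync
only adds a common drift to all angles; modulo rotations the closed loop is therefore the shifted
droop system. On a tree the incidence matrix is injective on edge space, so the power flow equation
determines the sines of the angle differences, which gives existence and uniqueness of equilibria.

Stability: along solutions the weighted square sum of the inverter residuals P' - P_e(theta)
decreases exponentially as long as the angle differences stay near the equilibrium, and there the
residual is comparable to the distance to the orbit; a bootstrap argument removes the proviso.
Solutions of the differential-algebraic system are obtained from a globally Lipschitz vector field
that agrees with the index-reduced one near the equilibrium.
*)
theory Submission
  imports Defs
begin

section \<open>Ordinary differential equations\<close>

text \<open>The loads are the obstacle: their equations determine the load velocities, with bounds,
  only while the cosines on the lines stay positive, so existence for all times is not automatic.
  The estimates never eliminate the loads. The inverter residuals serve as Lyapunov function because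
  each is \<open>D i\<close> times a drift-corrected velocity, while its derivative is minus a flow
  rate, which vanishes at the loads. The energy loss is therefore a Dirichlet form of the velocity
  over all nodes, and a Poincare inequality bounds it below by a multiple of the energy. That
  inequality is normalised by the \<open>D\<close>-weighted mean over the inverters, which is 0
  along motions because the residuals sum to 0. The Lipschitz vector field replaces each cosine by
  its maximum with a constant \<open>c > 0\<close>; the same decay estimate shows that solutions
  starting close enough never meet the region where this changes anything. Besides the network, the
  constants depend only on \<open>c\<close> and the allowed deviation, so they serve all points of
  an orbit, in all lifts, at once.\<close>

lemma norm_integral_exp_bound:
  fixes f :: "real \<Rightarrow> 'a::banach"
  assumes "l > 0" "t \<ge> 0" "continuous_on {0..t} f"
    and bound: "\<And>s. s \<in> {0..t} \<Longrightarrow> norm (f s) \<le> N * exp (l * s)"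
  shows "norm (integral {0..t} f) \<le> N / l * exp (l * t)"
proof -
  have N: "N \<ge> 0"
    using bound[of 0] \<open>t \<ge> 0\<close> order_trans[OF norm_ge_zero[of "f 0"]] by simp
  have "((\<lambda>s. N * exp (l * s)) has_integral (N / l * exp (l * t) - N / l * exp (l * 0))) {0..t}"
    using assms(1,2)
    by (intro fundamental_theorem_of_calculus)
       (auto intro!: derivative_eq_intros simp flip: has_real_derivative_iff_has_vector_derivative)
  then have "norm (integral {0..t} f) \<le> N / l * exp (l * t) - N / l * exp (l * 0)"
    using integral_norm_bound_integral[of f "{0..t}" "\<lambda>s. N * exp (l * s)"] bound assms(3)
    by (metis has_integral_integrable has_integral_integrable_integral integrable_continuous_real)
  then show ?thesis
    using N \<open>l > 0\<close> by (smt (verit) divide_nonneg_pos exp_zero mult_cancel_left1 mult_zero_right)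
qed

lemma integral_has_vector_derivative_halfline:
  fixes f :: "real \<Rightarrow> 'a::banach"
  assumes "continuous_on {0..} f" "t \<ge> 0"
  shows "((\<lambda>u. integral {0..u} f) has_vector_derivative f t) (at t within {0..})"
proof -
  have "((\<lambda>u. integral {0..u} f) has_vector_derivative f t) (at t within {0..t+1})"
    using assms by (intro integral_has_vector_derivative continuous_on_subset[OF assms(1)]) auto
  moreover have "at t within {0..t+1} = at t within {0..}"
    using assms by (intro at_within_nhd[of _ "{..<t+1}"]) auto
  ultimately show ?thesis by simp
qed

text \<open>
  The Picard operator is a contraction for the weighted supremum norm
  \<open>\<Squnion>t. exp (- l * t) * norm (x t)\<close> with \<open>l > L\<close>, so that no gluing of local solutions is
  needed. Below, \<open>y t\<close> stands for \<open>exp (- l * t) *\<^sub>R x t\<close>.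
\<close>

lemma global_lipschitz_ode_solution:
  fixes F :: "'a::banach \<Rightarrow> 'a"
  assumes lip: "\<And>x y. norm (F x - F y) \<le> L * norm (x - y)"
  obtains x where "x 0 = x0" "\<And>t. t \<ge> 0 \<Longrightarrow> (x has_vector_derivative F (x t)) (at t within {0..})"
proof -
  \<comment> \<open>The shift makes the Lipschitz constant positive; \<open>l = 2 * M\<close> then
    gives the contraction factor \<open>M / l = 1/2\<close>.\<close>
  define M where "M = \<bar>L\<bar> + 1"
  define l where "l = 2 * M"
  have M: "M > 0" "l > 0" by (auto simp: M_def l_def)
  have lipM: "norm (F x - F y) \<le> M * norm (x - y)" for x y
    by (rule order_trans[OF lip]) (auto intro!: mult_right_mono simp: M_def)
  then have contF: "continuous_on S F" for S
    by (intro lipschitz_on_continuous_on[OF lipschitz_onI]) (auto simp: dist_norm M_def)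
  define f where "f y s = F (exp (l * s) *\<^sub>R y s)" for y :: "real \<Rightarrow> 'a" and s
  define G where "G y t = integral {0..t} (f y)" for y t
  \<comment> \<open>Bounded continuous functions live on the whole line, so \<open>T y\<close> is
    extended to negative times by its value \<open>x0\<close> at 0.\<close>
  define T where "T y t = exp (- l * max 0 t) *\<^sub>R (x0 + G y (max 0 t))" for y t
  have contf: "continuous_on S (f y)" if "continuous_on UNIV y" for y S
    unfolding f_def
    by (intro continuous_on_compose2[OF contF[of UNIV]] continuous_intros
        continuous_on_subset[OF that]) auto
  have derG: "(G y has_vector_derivative f y t) (at t within {0..})"
    if "continuous_on UNIV y" "t \<ge> 0" for y t
    unfolding G_def by (rule integral_has_vector_derivative_halfline[OF contf[OF that(1)] that(2)])
  have contG: "continuous_on {0..} (G y)" if "continuous_on UNIV y" for y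
    using derG[OF that] by (meson atLeast_iff continuous_on_eq_continuous_within has_vector_derivative_continuous)
  have contT: "continuous_on UNIV (T y)" if "continuous_on UNIV y" for y
    unfolding T_def by (intro continuous_intros continuous_on_compose2[OF contG[OF that]]) auto
  have Tb: "T y \<in> bcontfun" if y: "y \<in> bcontfun" for y
  proof -
    from y obtain C where C: "\<And>t. norm (y t) \<le> C" and cy: "continuous_on UNIV y"
      by (auto simp: bcontfun_def bounded_iff)
    have "norm (T y t) \<le> norm x0 + (norm (F 0) + M * C) / l" for t
    proof -
      define m where "m = max 0 t"
      have "m \<ge> 0" by (simp add: m_def)
      have "norm (f y s) \<le> (norm (F 0) + M * C) * exp (l * s)" if "s \<in> {0..m}" for s
      proof -
        have "norm (f y s) \<le> norm (F 0) + norm (F (exp (l * s) *\<^sub>R y s) - F 0)"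
          unfolding f_def by norm
        also have "\<dots> \<le> norm (F 0) + M * (exp (l * s) * norm (y s))"
          using lipM[of "exp (l * s) *\<^sub>R y s" 0] by simp
        also have "\<dots> \<le> norm (F 0) * exp (l * s) + M * (exp (l * s) * C)"
          using C[of s] M that
          by (intro add_mono mult_left_mono) (auto simp: mult_le_cancel_left1)
        finally show ?thesis by (simp add: algebra_simps)
      qed
      then have "norm (G y m) \<le> (norm (F 0) + M * C) / l * exp (l * m)"
        unfolding G_def by (intro norm_integral_exp_bound M \<open>m \<ge> 0\<close> contf cy)
      then have "exp (- l * m) * norm (G y m) \<le> exp (- l * m) * ((norm (F 0) + M * C) / l * exp (l * m))"
        by (intro mult_left_mono) auto
      also have "\<dots> = (norm (F 0) + M * C) / l"
        by (simp add: exp_minus)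
      finally have 1: "exp (- l * m) * norm (G y m) \<le> (norm (F 0) + M * C) / l" .
      have 2: "exp (- l * m) * norm x0 \<le> norm x0"
        using \<open>m \<ge> 0\<close> M by (intro mult_left_le_one_le) auto
      have "norm (T y t) = exp (- l * m) * norm (x0 + G y m)"
        by (simp add: T_def m_def)
      also have "\<dots> \<le> exp (- l * m) * (norm x0 + norm (G y m))"
        by (intro mult_left_mono norm_triangle_ineq) auto
      finally show ?thesis using 1 2 by (simp add: algebra_simps)
    qed
    then show ?thesis
      using contT[OF cy] by (auto simp: bcontfun_def bounded_iff)
  qed
  define H where "H y = Bcontfun (T (apply_bcontfun y))" for y :: "real \<Rightarrow>\<^sub>C 'a"
  have H: "apply_bcontfun (H y) = T (apply_bcontfun y)" for y
    unfolding H_def by (intro Bcontfun_inverse Tb apply_bcontfun)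
  have "dist (H y) (H z) \<le> 1/2 * dist y z" for y z
  proof (rule dist_bound)
    fix t :: real
    define m where "m = max 0 t"
    have "m \<ge> 0" by (simp add: m_def)
    have c: "continuous_on S (f (apply_bcontfun y))" for y S
      by (intro contf) auto
    have "norm (f y s - f z s) \<le> M * dist y z * exp (l * s)" for s
    proof -
      have "norm (f y s - f z s) \<le> M * norm (exp (l * s) *\<^sub>R y s - exp (l * s) *\<^sub>R z s)"
        unfolding f_def by (rule lipM)
      also have "\<dots> = M * (exp (l * s) * norm (y s - z s))"
        by (simp flip: scaleR_diff_right)
      also have "\<dots> \<le> M * (exp (l * s) * dist y z)"
        using dist_bounded[of y s z] M by (intro mult_left_mono) (auto simp: dist_norm)
      finally show ?thesis by (simp add: algebra_simps)
    qed
    then have "norm (integral {0..m} (\<lambda>s. f y s - f z s)) \<le> M * dist y z / l * exp (l * m)"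
      by (intro norm_integral_exp_bound M \<open>m \<ge> 0\<close> continuous_intros c) auto
    also have "integral {0..m} (\<lambda>s. f y s - f z s) = G y m - G z m"
      unfolding G_def by (intro integral_diff integrable_continuous_real c)
    also have "M * dist y z / l * exp (l * m) = 1/2 * dist y z * exp (l * m)"
      using M by (simp add: l_def)
    finally have *: "norm (G y m - G z m) \<le> 1/2 * dist y z * exp (l * m)" .
    have "dist (H y t) (H z t) = norm (exp (- l * m) *\<^sub>R (G y m - G z m))"
      by (simp add: H T_def m_def dist_norm algebra_simps)
    also have "\<dots> = exp (- l * m) * norm (G y m - G z m)" by simp
    also have "\<dots> \<le> exp (- l * m) * (1/2 * dist y z * exp (l * m))"
      using * by (intro mult_left_mono) auto
    also have "\<dots> = 1/2 * dist y z" by (simp add: exp_minus)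
    finally show "dist (H y t) (H z t) \<le> 1/2 * dist y z" .
  qed
  then obtain y where y: "H y = y"
    using banach_fix_type[of "1/2" H] by auto
  define x where "x t = x0 + G y t" for t
  have "(x has_vector_derivative F (x t)) (at t within {0..})" if "t \<ge> 0" for t
  proof -
    have "apply_bcontfun y t = T y t"
      using H[of y] y by metis
    then have "exp (l * t) *\<^sub>R y t = x t"
      using that by (simp add: T_def x_def exp_minus)
    then have "f y t = F (x t)" by (simp add: f_def)
    moreover have "(x has_vector_derivative f y t) (at t within {0..})"
      unfolding x_def using derG[of y t] that
      by (auto intro!: derivative_eq_intros)
    ultimately show ?thesis by simp
  qed
  moreover have "x 0 = x0" by (simp add: x_def G_def)
  ultimately show ?thesis by (rule that[rotated])
qed

text \<open>At the first time at which \<open>m\<close> equals \<open>e\<close>, all earlier values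
  are at most \<open>e\<close>, so \<open>step\<close> gives a value below \<open>e\<close>, a
  contradiction. Compactness of the set of such times provides the first one. This turns estimates
  that hold only near an equilibrium into unconditional ones.\<close>

lemma bootstrap_less:
  fixes m :: "real \<Rightarrow> real"
  assumes cont: "continuous_on {0..} m" and "m 0 < e"
    and step: "\<And>T. T \<ge> 0 \<Longrightarrow> (\<And>t. t \<in> {0..T} \<Longrightarrow> m t \<le> e) \<Longrightarrow> m T < e"
    and "t \<ge> 0"
  shows "m t < e"
proof (rule ccontr)
  assume "\<not> m t < e"
  define S where "S = {s \<in> {0..t}. m s = e}"
  have c: "continuous_on {0..u} m" for u
    by (rule continuous_on_subset[OF cont]) auto
  have ivt: "\<exists>s\<in>{0..u}. m s = e" if "u \<ge> 0" "e \<le> m u" for u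
    using IVT'[of m 0 e u] that \<open>m 0 < e\<close> c by force
  have "S \<noteq> {}"
    using ivt[of t] \<open>t \<ge> 0\<close> \<open>\<not> m t < e\<close> by (auto simp: S_def)
  have "closed S"
    unfolding S_def by (rule continuous_closed_preimage_constant[OF c]) simp
  moreover have "bounded S"
    by (rule bounded_subset[of "{0..t}"]) (auto simp: S_def)
  ultimately have "compact S"
    by (simp add: compact_eq_bounded_closed)
  then obtain T where T: "T \<in> S" "\<And>s. s \<in> S \<Longrightarrow> T \<le> s"
    using compact_attains_inf[OF _ \<open>S \<noteq> {}\<close>] by blast
  have "m u \<le> e" if "u \<in> {0..T}" for u
  proof (rule ccontr)
    assume "\<not> m u \<le> e"
    with that obtain s where "s \<in> {0..u}" "m s = e" using ivt[of u] by auto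
    moreover from this have "s \<in> S" using that T(1) by (auto simp: S_def)
    ultimately have "s = u" using T(2)[of s] that by auto
    with \<open>\<not> m u \<le> e\<close> \<open>m s = e\<close> show False by simp
  qed
  with T(1) step[of T] show False by (auto simp: S_def)
qed

text \<open>Gronwall: \<open>exp (r * t) * v t\<close> does not increase. Derivatives are asked for
  at interior times only, where those on the half-line are two-sided.\<close>

lemma exp_decay_of_derivative_bound:
  fixes v :: "real \<Rightarrow> real"
  assumes "continuous_on {0..T} v" "T \<ge> 0"
    and "\<And>t. 0 < t \<Longrightarrow> t < T \<Longrightarrow> (v has_real_derivative v' t) (at t)"
    and "\<And>t. 0 < t \<Longrightarrow> t < T \<Longrightarrow> v' t \<le> - r * v t"
  shows "v T \<le> exp (- r * T) * v 0"
proof -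
  define h where "h t = exp (r * t) * v t" for t
  have "\<exists>y. (h has_real_derivative y) (at t) \<and> y \<le> 0" if t: "0 < t" "t < T" for t
  proof (intro exI conjI)
    show "(h has_real_derivative exp (r * t) * (v' t + r * v t)) (at t)"
      unfolding h_def
      by (auto intro!: derivative_eq_intros assms(3) t simp: algebra_simps)
    show "exp (r * t) * (v' t + r * v t) \<le> 0"
      using assms(4)[OF t] by (simp add: mult_le_0_iff)
  qed
  then have "h T \<le> h 0"
    unfolding h_def
    by (intro DERIV_nonpos_imp_decreasing_open[OF \<open>T \<ge> 0\<close>] continuous_intros assms(1))
  then show ?thesis
    by (simp add: h_def exp_minus field_simps)
qed

section \<open>Droop dynamics on a weighted network\<close>

lemma norm_weighted_le:
  fixes y :: "real ^ 'e::finite"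
  assumes "\<And>e. \<bar>c e\<bar> \<le> b"
  shows "norm (\<chi> e. c e * y $ e) \<le> b * norm y"
proof -
  have "b \<ge> 0" using assms[of undefined] by linarith
  then have "norm (\<chi> e. c e * y $ e) \<le> norm (b *\<^sub>R y)"
    using assms by (intro norm_le_componentwise_cart) (auto simp: abs_mult intro!: mult_right_mono)
  with \<open>b \<ge> 0\<close> show ?thesis by simp
qed

lemma power2_norm_vec: "(norm x)\<^sup>2 = (\<Sum>i\<in>UNIV. (x $ i)\<^sup>2)" for x :: "real ^ 'n::finite"
  by (simp add: power2_norm_eq_inner inner_vec_def flip: power2_eq_square)

lemma abs_sin_diff_le: "\<bar>sin x - sin y\<bar> \<le> \<bar>x - y\<bar>" for x y :: real
proof -
  have "norm (sin x - sin y) \<le> 1 * norm (x - y)"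
    by (rule field_differentiable_bound[of UNIV sin cos])
       (auto intro: DERIV_sin has_field_derivative_at_within)
  then show ?thesis by simp
qed

lemma abs_cos_diff_le: "\<bar>cos x - cos y\<bar> \<le> \<bar>x - y\<bar>" for x y :: real
  using abs_sin_diff_le[of "pi/2 - x" "pi/2 - y"] by (simp add: sin_diff abs_minus_commute)

text \<open>Strong monotonicity of sine: by the mean value theorem the difference quotient is a
  cosine between \<open>x\<close> and \<open>y\<close>. The hypothesis is centred at
  \<open>y\<close> because the cosine bound will be known around an equilibrium.\<close>

lemma sin_diff_mult_ge:
  fixes x y :: real
  assumes "\<And>z. \<bar>z - y\<bar> \<le> \<bar>x - y\<bar> \<Longrightarrow> c \<le> cos z"
  shows "c * (x - y)\<^sup>2 \<le> (sin x - sin y) * (x - y)"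
proof -
  have "\<exists>z. \<bar>z - y\<bar> \<le> \<bar>x - y\<bar> \<and> sin x - sin y = (x - y) * cos z"
  proof (cases x y rule: linorder_cases)
    case less
    obtain z where "x < z" "z < y" "sin y - sin x = (y - x) * cos z"
      using MVT2[OF less, of sin cos] DERIV_sin by blast
    then show ?thesis by (intro exI[of _ z]) (auto simp: algebra_simps)
  next
    case equal
    then show ?thesis by (auto intro: exI[of _ x])
  next
    case greater
    obtain z where "y < z" "z < x" "sin x - sin y = (x - y) * cos z"
      using MVT2[OF greater, of sin cos] DERIV_sin by blast
    then show ?thesis by (intro exI[of _ z]) auto
  qed
  then obtain z where "c \<le> cos z" "sin x - sin y = (x - y) * cos z"
    using assms by auto
  then show ?thesis
    using mult_right_mono[of c "cos z" "(x - y)\<^sup>2"] by (simp add: power2_eq_square mult_ac)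
qed

text \<open>Edge vectors may have indices that are not lines; these carry weight 0, and
  \<open>zero_weight\<close> makes tensions vanish there, so that norms of tensions see the lines
  only. \<open>kernel\<close> encodes connectedness.\<close>

locale flow_network =
  fixes B :: "real ^ 'e::finite ^ 'n::finite" and a :: "real ^ 'e"
    and I :: "'n set" and D :: "'n \<Rightarrow> real" and P :: "real ^ 'n"
  assumes a_nonneg: "a $ e \<ge> 0"
    and zero_weight: "a $ e = 0 \<Longrightarrow> (transpose B *v \<theta>) $ e = 0"
    and kernel: "transpose B *v \<theta> = 0 \<longleftrightarrow> (\<exists>c. \<theta> = vec c)"
    and I_nonempty: "I \<noteq> {}"
    and D_pos: "i \<in> I \<Longrightarrow> D i > 0"
    and balanced: "(\<Sum>i\<in>UNIV. P $ i) = 0"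
begin

section \<open>Tensions, injections and residuals\<close>

definition "tension \<theta> = transpose B *v \<theta>"

lemma tension_eq_0: "a $ e = 0 \<Longrightarrow> tension \<theta> $ e = 0"
  using zero_weight by (simp add: tension_def)

lemma tension_kernel: "tension \<theta> = 0 \<longleftrightarrow> (\<exists>c. \<theta> = vec c)"
  using kernel by (simp add: tension_def)

lemma bounded_linear_tension: "bounded_linear tension"
  unfolding tension_def by (rule matrix_vector_mul_bounded_linear)

lemma tension_add: "tension (\<theta> + \<phi>) = tension \<theta> + tension \<phi>"
  and tension_diff: "tension (\<theta> - \<phi>) = tension \<theta> - tension \<phi>"
  and tension_scaleR: "tension (c *\<^sub>R \<theta>) = c *\<^sub>R tension \<theta>"
  using bounded_linear_tension by (simp_all add: linear_simps)

definition "injection \<theta> = B *v (\<chi> e. a $ e * sin (tension \<theta> $ e))"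

definition "residual \<theta> = P - injection \<theta>"

lemma inner_B: "(B *v f) \<bullet> w = f \<bullet> tension w"
  unfolding tension_def by (metis dot_lmul_matrix inner_commute transpose_matrix_vector)

lemma tension_vec [simp]: "tension (vec c) = 0"
  using tension_kernel by blast

lemma inner_B_vec [simp]: "(B *v f) \<bullet> vec c = 0"
  by (simp add: inner_B)

lemma tension_add_vec [simp]: "tension (\<theta> + vec c) = tension \<theta>"
  by (simp add: tension_add)

lemma residual_sum: "(\<Sum>i\<in>UNIV. residual \<theta> $ i) = 0"
proof -
  have "injection \<theta> \<bullet> vec 1 = 0" unfolding injection_def by (rule inner_B_vec)
  then have "(\<Sum>i\<in>UNIV. injection \<theta> $ i) = 0" by (simp add: inner_vec_def)
  then show ?thesis
    using balanced by (simp add: residual_def sum_subtractf)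
qed

lemma residual_inner_vec [simp]: "residual \<theta> \<bullet> vec c = 0"
  using residual_sum[of \<theta>] by (simp add: inner_vec_def flip: sum_distrib_right)

text \<open>A positive lower bound for the nonzero weights; the element 1 covers networks without
  lines.\<close>

definition "\<alpha> = Min (insert 1 {a $ e |e. a $ e \<noteq> 0})"

lemma \<alpha>_pos: "\<alpha> > 0"
  using a_nonneg by (auto simp: \<alpha>_def order.not_eq_order_implies_strict)

lemma \<alpha>_le: "a $ e \<noteq> 0 \<Longrightarrow> \<alpha> \<le> a $ e"
  unfolding \<alpha>_def by (rule Min_le) auto

text \<open>Coercivity of the Dirichlet form holds line by line; indices of weight 0 do no harm
  because the tension vanishes there.\<close>

lemma weighted_tension_ge:
  assumes "c \<ge> 0" "\<And>e. c * a $ e \<le> C e"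
  shows "c * \<alpha> * (norm (tension w))\<^sup>2 \<le> (\<chi> e. C e * tension w $ e) \<bullet> tension w"
proof -
  have "c * \<alpha> * (tension w $ e)\<^sup>2 \<le> C e * (tension w $ e)\<^sup>2" for e
  proof (cases "a $ e = 0")
    case True
    then show ?thesis using tension_eq_0[of e w] by simp
  next
    case False
    have "c * \<alpha> \<le> c * a $ e" using \<alpha>_le[OF False] assms(1) by (rule mult_left_mono)
    also note assms(2)[of e]
    finally show ?thesis by (intro mult_right_mono) auto
  qed
  then show ?thesis
    by (simp add: power2_norm_eq_inner inner_vec_def sum_distrib_left sum_mono mult.assoc
        flip: power2_eq_square)
qed

text \<open>A Poincare constant. The normalisation fits both applications: drift-corrected
  velocities, whose weighted sum is a sum of residuals, and vectors that vanish at all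
  inverters.\<close>

definition "\<kappa> = (SOME \<kappa>. \<kappa> > 0 \<and>
  (\<forall>w. (\<Sum>i\<in>I. D i * w $ i) = 0 \<longrightarrow> \<kappa> * norm w \<le> norm (tension w)))"

lemma sum_D_pos: "(\<Sum>i\<in>I. D i) > 0"
  by (intro sum_pos) (auto simp: I_nonempty D_pos)

text \<open>A constant vector whose \<open>D\<close>-weighted sum is 0 vanishes, so
  \<open>tension\<close> is injective on this subspace; an injective linear map in finite dimension
  is bounded below.\<close>

lemma \<kappa>_pos: "\<kappa> > 0"
  and poincare: "(\<Sum>i\<in>I. D i * w $ i) = 0 \<Longrightarrow> \<kappa> * norm w \<le> norm (tension w)"
proof -
  define S where "S = {w :: real^'n. (\<Sum>i\<in>I. D i * w $ i) = 0}"
  have "subspace S"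
    by (auto simp: S_def subspace_def distrib_left sum.distrib mult.left_commute simp flip: sum_distrib_left)
  moreover have "\<forall>w\<in>S. tension w = 0 \<longrightarrow> w = 0"
  proof safe
    fix w assume "w \<in> S" "tension w = 0"
    then obtain c where "w = vec c" using tension_kernel by auto
    with \<open>w \<in> S\<close> have "(\<Sum>i\<in>I. D i) * c = 0" by (simp add: S_def sum_distrib_right)
    with sum_D_pos \<open>w = vec c\<close> show "w = 0" by (simp add: vec_eq_iff)
  qed
  ultimately have "\<exists>\<kappa>>0. \<forall>w\<in>S. \<kappa> * norm w \<le> norm (tension w)"
    by (intro injective_imp_isometric closed_subspace bounded_linear_tension) auto
  then have "\<exists>\<kappa>>0. \<forall>w. (\<Sum>i\<in>I. D i * w $ i) = 0 \<longrightarrow> \<kappa> * norm w \<le> norm (tension w)"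
    by (auto simp: S_def)
  from someI_ex[OF this] show "\<kappa> > 0"
    "(\<Sum>i\<in>I. D i * w $ i) = 0 \<Longrightarrow> \<kappa> * norm w \<le> norm (tension w)"
    by (auto simp: \<kappa>_def)
qed

text \<open>Subtracting the weighted mean reduces this to \<open>poincare\<close>. It converts
  bounds on tensions into bounds on the distance to a rotation orbit.\<close>

lemma obtain_rotation:
  obtains c where "\<kappa> * norm (w - vec c) \<le> norm (tension w)"
proof -
  define c where "c = (\<Sum>i\<in>I. D i * w $ i) / (\<Sum>i\<in>I. D i)"
  have "(\<Sum>i\<in>I. D i * (w - vec c) $ i) = (\<Sum>i\<in>I. D i * w $ i) - c * (\<Sum>i\<in>I. D i)"
    by (simp add: algebra_simps sum_subtractf sum_distrib_left)
  also have "\<dots> = 0" using sum_D_pos by (simp add: c_def)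
  finally have "\<kappa> * norm (w - vec c) \<le> norm (tension (w - vec c))" by (rule poincare)
  then show ?thesis by (intro that) (simp add: tension_diff)
qed

section \<open>Operator norms and bounds for injections and residuals\<close>

definition "bB = onorm ((*v) B)"
definition "bT = onorm tension"

lemma norm_B_le: "norm (B *v f) \<le> bB * norm f"
  unfolding bB_def by (rule onorm) (rule matrix_vector_mul_bounded_linear)

lemma norm_tension_le: "norm (tension w) \<le> bT * norm w"
  unfolding bT_def by (rule onorm) (rule bounded_linear_tension)

lemma bB_nonneg: "bB \<ge> 0" and bT_nonneg: "bT \<ge> 0"
  unfolding bB_def bT_def
  by (intro onorm_pos_le matrix_vector_mul_bounded_linear bounded_linear_tension)+

lemma a_le_norm: "\<bar>a $ e\<bar> \<le> norm a"
  by (rule component_le_norm_cart)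

lemma injection_lipschitz:
  "norm (injection \<theta> - injection \<phi>) \<le> bB * norm a * bT * norm (\<theta> - \<phi>)"
proof -
  let ?f = "\<lambda>\<theta>. (\<chi> e. a $ e * sin (tension \<theta> $ e))"
  have "\<bar>a $ e\<bar> * \<bar>sin (tension \<theta> $ e) - sin (tension \<phi> $ e)\<bar>
      \<le> norm a * \<bar>tension \<theta> $ e - tension \<phi> $ e\<bar>" for e
    by (intro mult_mono a_le_norm abs_sin_diff_le) auto
  then have "norm (?f \<theta> - ?f \<phi>) \<le> norm (norm a *\<^sub>R tension (\<theta> - \<phi>))"
    by (intro norm_le_componentwise_cart)
       (auto simp: tension_diff abs_mult simp flip: right_diff_distrib)
  also have "\<dots> \<le> norm a * (bT * norm (\<theta> - \<phi>))"
    by (simp add: norm_tension_le mult_left_mono)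
  finally have "bB * norm (?f \<theta> - ?f \<phi>) \<le> bB * (norm a * (bT * norm (\<theta> - \<phi>)))"
    by (intro mult_left_mono bB_nonneg)
  then show ?thesis
    using norm_B_le[of "?f \<theta> - ?f \<phi>"]
    by (simp add: injection_def matrix_vector_mult_diff_distrib mult.assoc)
qed

lemma residual_bounded: "norm (residual \<theta>) \<le> norm P + bB * norm a"
proof -
  have "norm (\<chi> e. a $ e * sin (tension \<theta> $ e)) \<le> norm a"
    by (intro norm_le_componentwise_cart) (auto simp: abs_mult intro!: mult_left_le)
  then have "bB * norm (\<chi> e. a $ e * sin (tension \<theta> $ e)) \<le> bB * norm a"
    by (intro mult_left_mono bB_nonneg)
  then show ?thesis
    unfolding residual_def injection_def
    using norm_triangle_ineq4[of P "B *v (\<chi> e. a $ e * sin (tension \<theta> $ e))"] norm_B_le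
    by (smt (verit))
qed

section \<open>The load equations and the regularized velocity field\<close>

lemma load_response_le:
  assumes h: "\<And>i. i \<in> I \<Longrightarrow> h $ i = 0" and "c > 0" and C: "\<And>e. c * a $ e \<le> C e"
    and eq: "\<And>i. i \<notin> I \<Longrightarrow> (B *v (\<chi> e. C e * tension h $ e)) $ i = (B *v y) $ i"
  shows "norm (tension h) \<le> norm y / (c * \<alpha>)"
proof -
  have ca: "c * \<alpha> > 0" using \<open>c > 0\<close> \<alpha>_pos by simp
  \<comment> \<open>The equations are tested with \<open>h\<close> itself. As \<open>h\<close>
    vanishes at the inverters, the load equations suffice, and coercivity plays against
    Cauchy-Schwarz.\<close>
  have "c * \<alpha> * (norm (tension h))\<^sup>2 \<le> (\<chi> e. C e * tension h $ e) \<bullet> tension h"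
    using \<open>c > 0\<close> C by (intro weighted_tension_ge) auto
  also have "\<dots> = (B *v (\<chi> e. C e * tension h $ e)) \<bullet> h"
    by (simp add: inner_B)
  also have "\<dots> = (B *v y) \<bullet> h"
    unfolding inner_vec_def by (rule sum.cong) (use h eq in fastforce)+
  also have "\<dots> = y \<bullet> tension h"
    by (rule inner_B)
  also have "\<dots> \<le> norm y * norm (tension h)"
    by (rule norm_cauchy_schwarz)
  finally have "norm (tension h) * (c * \<alpha> * norm (tension h)) \<le> norm (tension h) * norm y"
    by (simp add: power2_eq_square mult_ac)
  then have "c * \<alpha> * norm (tension h) \<le> norm y"
    by (cases "tension h = 0") (auto simp: mult_le_cancel_left)
  with ca show ?thesis by (simp add: field_simps)
qed

lemma load_poincare:
  assumes "\<And>i. i \<in> I \<Longrightarrow> h $ i = 0"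
  shows "\<kappa> * norm h \<le> norm (tension h)"
  using assms by (intro poincare sum.neutral) auto

text \<open>
  The load velocities solve the time derivative of the algebraic load equations. Its coefficients
  \<open>a\<^sub>e cos x\<^sub>e\<close> are bounded from below by \<open>c a\<^sub>e\<close> here, which makes the vector field globally
  Lipschitz and changes nothing near the equilibrium.
\<close>

definition "stiffness c \<theta> e = a $ e * max c (cos (tension \<theta> $ e))"

definition "is_velocity c \<theta> w \<longleftrightarrow> (\<forall>i\<in>I. D i * w $ i = residual \<theta> $ i) \<and>
  (\<forall>i. i \<notin> I \<longrightarrow> (B *v (\<chi> e. stiffness c \<theta> e * tension w $ e)) $ i = 0)"

lemma stiffness_ge: "c * a $ e \<le> stiffness c \<theta> e"
  unfolding stiffness_def using a_nonneg[of e] by (subst mult.commute) (rule mult_left_mono; simp)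

lemma stiffness_abs_le: "0 < c \<Longrightarrow> c \<le> 1 \<Longrightarrow> \<bar>stiffness c \<theta> e\<bar> \<le> norm a"
  unfolding stiffness_def abs_mult
  by (rule order_trans[OF mult_left_le[of _ "\<bar>a $ e\<bar>"] a_le_norm]) (auto simp: max_def)

lemma stiffness_lipschitz:
  "\<bar>stiffness c \<theta> e - stiffness c \<phi> e\<bar> \<le> norm a * \<bar>tension (\<theta> - \<phi>) $ e\<bar>"
proof -
  have "\<bar>max c x - max c y\<bar> \<le> \<bar>x - y\<bar>" for x y :: real
    by (auto simp: max_def)
  also have "\<bar>cos (tension \<theta> $ e) - cos (tension \<phi> $ e)\<bar> \<le> \<bar>tension (\<theta> - \<phi>) $ e\<bar>"
    unfolding tension_diff vector_minus_component by (rule abs_cos_diff_le)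
  finally have "\<bar>a $ e\<bar> * \<bar>max c (cos (tension \<theta> $ e)) - max c (cos (tension \<phi> $ e))\<bar>
      \<le> norm a * \<bar>tension (\<theta> - \<phi>) $ e\<bar>"
    by (intro mult_mono a_le_norm) auto
  then show ?thesis
    by (simp add: stiffness_def abs_mult flip: right_diff_distrib)
qed

text \<open>This is a square linear system, so injectivity is enough. A kernel vector vanishes at
  the inverters and has zero right-hand side at the loads: \<open>load_response_le\<close> removes
  its tension and \<open>load_poincare\<close> the vector.\<close>

lemma is_velocity_exists:
  assumes "c > 0"
  shows "\<exists>w. is_velocity c \<theta> w"
proof -
  define M where "M w = (\<chi> i. if i \<in> I then w $ i
    else (B *v (\<chi> e. stiffness c \<theta> e * tension w $ e)) $ i)" for w
  have add: "(\<chi> e. stiffness c \<theta> e * tension (x + y) $ e) =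
      (\<chi> e. stiffness c \<theta> e * tension x $ e) + (\<chi> e. stiffness c \<theta> e * tension y $ e)" for x y
    by (simp add: vec_eq_iff tension_add distrib_left)
  have scale: "(\<chi> e. stiffness c \<theta> e * tension (r *\<^sub>R x) $ e) =
      r *\<^sub>R (\<chi> e. stiffness c \<theta> e * tension x $ e)" for r x
    by (simp add: vec_eq_iff tension_scaleR)
  have "linear M"
    by (intro linearI)
       (auto simp: M_def vec_eq_iff add scale matrix_vector_right_distrib matrix_vector_mult_scaleR)
  moreover have "w = 0" if "M w = 0" for w
  proof -
    have 0: "M w $ i = 0" for i using that by simp
    have I: "w $ i = 0" if "i \<in> I" for i using 0[of i] that by (simp add: M_def)
    have "norm (tension w) \<le> norm (0 :: real^'e) / (c * \<alpha>)"
    proof (rule load_response_le[OF I \<open>c > 0\<close>, of "stiffness c \<theta>" 0])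
      show "(B *v (\<chi> e. stiffness c \<theta> e * tension w $ e)) $ i = (B *v 0) $ i" if "i \<notin> I" for i
        using 0[of i] that by (simp add: M_def)
    qed (auto simp: stiffness_ge)
    then show "w = 0"
      using load_poincare[OF I] \<kappa>_pos by (simp add: mult_le_0_iff)
  qed
  ultimately have "surj M"
    by (intro linear_injective_imp_surjective) (auto simp: linear_injective_0)
  then obtain w where w: "M w = (\<chi> i. if i \<in> I then residual \<theta> $ i / D i else 0)"
    by (metis surjD)
  have "D i * w $ i = residual \<theta> $ i" if "i \<in> I" for i
    using arg_cong[OF w, of "\<lambda>x. x $ i"] that D_pos[OF that] by (simp add: M_def)
  moreover have "(B *v (\<chi> e. stiffness c \<theta> e * tension w $ e)) $ i = 0" if "i \<notin> I" for i
    using arg_cong[OF w, of "\<lambda>x. x $ i"] that by (simp add: M_def)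
  ultimately have "is_velocity c \<theta> w"
    by (simp add: is_velocity_def)
  then show ?thesis by blast
qed

definition "velocity c \<theta> = (SOME w. is_velocity c \<theta> w)"

lemma velocity: "c > 0 \<Longrightarrow> is_velocity c \<theta> (velocity c \<theta>)"
  unfolding velocity_def by (rule someI_ex) (rule is_velocity_exists)

text \<open>The velocity prescribed at the inverters, extended by 0 to the loads. Once it is
  subtracted, what remains vanishes at the inverters, as \<open>load_response_le\<close>
  demands.\<close>

definition "drive r = (\<chi> i. (if i \<in> I then 1 / D i else 0) * r $ i)" for r :: "real^'n"

definition "bD = (\<Sum>i\<in>I. 1 / D i)"

lemma D_nonzero: "i \<in> I \<Longrightarrow> D i \<noteq> 0"
  using D_pos by force

lemma inverse_D_le: "i \<in> I \<Longrightarrow> 1 / D i \<le> bD"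
  unfolding bD_def by (rule member_le_sum[where f = "\<lambda>i. 1 / D i"]) (auto intro: less_imp_le D_pos)

lemma bD_nonneg: "bD \<ge> 0"
  unfolding bD_def by (intro sum_nonneg) (auto intro: less_imp_le D_pos)

lemma norm_drive_le: "norm (drive r) \<le> bD * norm r"
  unfolding drive_def
proof (rule norm_weighted_le)
  show "\<bar>if i \<in> I then 1 / D i else 0\<bar> \<le> bD" for i
    using inverse_D_le[of i] D_pos[of i] bD_nonneg by auto
qed

lemma drive_diff: "drive (x - y) = drive x - drive y"
  by (simp add: drive_def vec_eq_iff algebra_simps)

lemma is_velocity_drive: "is_velocity c \<theta> w \<Longrightarrow> i \<in> I \<Longrightarrow> w $ i = drive (residual \<theta>) $ i"
  using D_pos[of i] by (auto simp: is_velocity_def drive_def field_simps)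

text \<open>Sines are bounded, hence so are residuals and inverter velocities, uniformly in the
  angles; the loads follow from \<open>load_response_le\<close> after \<open>drive\<close> is split
  off.\<close>

lemma velocity_tension_le:
  assumes "0 < c" "c \<le> 1" and w: "is_velocity c \<theta> w"
  shows "norm (tension w) \<le> (norm a / (c * \<alpha>) + 1) * (bT * (bD * (norm P + bB * norm a)))"
proof -
  define u where "u = drive (residual \<theta>)"
  define y where "y = (\<chi> e. - stiffness c \<theta> e * tension u $ e)"
  have ca: "c * \<alpha> > 0" using \<open>c > 0\<close> \<alpha>_pos by simp
  have "norm u \<le> bD * (norm P + bB * norm a)"
    unfolding u_def
    by (rule order_trans[OF norm_drive_le]) (intro mult_left_mono residual_bounded bD_nonneg)
  then have tu: "norm (tension u) \<le> bT * (bD * (norm P + bB * norm a))"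
    by (intro order_trans[OF norm_tension_le] mult_left_mono bT_nonneg)
  have "norm y \<le> norm a * norm (tension u)"
    unfolding y_def using stiffness_abs_le[OF assms(1,2)] by (intro norm_weighted_le) auto
  have "norm (tension (w - u)) \<le> norm y / (c * \<alpha>)"
  proof (rule load_response_le[OF _ \<open>0 < c\<close> stiffness_ge])
    show "(w - u) $ i = 0" if "i \<in> I" for i
      using is_velocity_drive[OF w that] by (simp add: u_def)
    have "(\<chi> e. stiffness c \<theta> e * tension (w - u) $ e) = (\<chi> e. stiffness c \<theta> e * tension w $ e) + y"
      by (simp add: y_def vec_eq_iff tension_diff algebra_simps)
    then show "(B *v (\<chi> e. stiffness c \<theta> e * tension (w - u) $ e)) $ i = (B *v y) $ i" if "i \<notin> I" for i
      using w that by (simp add: matrix_vector_right_distrib is_velocity_def)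
  qed
  also have "\<dots> \<le> norm a * norm (tension u) / (c * \<alpha>)"
    using ca \<open>norm y \<le> _\<close> by (intro divide_right_mono) auto
  finally have "norm (tension (w - u)) + norm (tension u) \<le> (norm a / (c * \<alpha>) + 1) * norm (tension u)"
    by (simp add: algebra_simps)
  also have "\<dots> \<le> (norm a / (c * \<alpha>) + 1) * (bT * (bD * (norm P + bB * norm a)))"
    using ca by (intro mult_left_mono tu) auto
  finally show ?thesis
    using norm_triangle_ineq[of "tension (w - u)" "tension u"] by (simp flip: tension_add)
qed

text \<open>Subtracting the load equations at the two angle vectors shows that the velocity
  difference minus the difference of drives solves load equations with two error terms: the tension
  of the drive difference, and the change of stiffness times the tension of a velocity. The second
  is globally Lipschitz only because that tension is bounded uniformly, by \<open>W\<close>.\<close>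

lemma velocity_lipschitz:
  assumes "0 < c" "c \<le> 1"
  obtains L where "\<And>\<theta> \<phi>. norm (velocity c \<theta> - velocity c \<phi>) \<le> L * norm (\<theta> - \<phi>)"
proof
  define W where "W = (norm a / (c * \<alpha>) + 1) * (bT * (bD * (norm P + bB * norm a)))"
  define U where "U = bD * (bB * norm a * bT)"
  fix \<theta> \<phi>
  define w v where "w = velocity c \<theta>" and "v = velocity c \<phi>"
  have w: "is_velocity c \<theta> w" and v: "is_velocity c \<phi> v"
    unfolding w_def v_def using velocity[OF \<open>c > 0\<close>] by auto
  define u where "u = drive (residual \<theta> - residual \<phi>)"
  define h where "h = w - v - u"
  define y where "y = (\<chi> e. - stiffness c \<theta> e * tension u $ e)
    + (\<chi> e. (stiffness c \<phi> e - stiffness c \<theta> e) * tension v $ e)"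
  define d where "d = norm (\<theta> - \<phi>)"
  have ca: "c * \<alpha> > 0" using \<open>c > 0\<close> \<alpha>_pos by simp
  have "norm u \<le> bD * norm (residual \<theta> - residual \<phi>)"
    unfolding u_def by (rule norm_drive_le)
  also have "\<dots> \<le> bD * (bB * norm a * bT * d)"
    unfolding d_def using injection_lipschitz[of \<theta> \<phi>]
    by (intro mult_left_mono bD_nonneg) (simp add: residual_def norm_minus_commute)
  finally have u: "norm u \<le> U * d" by (simp add: U_def mult.assoc)
  have "norm (tension v) \<le> W"
    unfolding W_def by (rule velocity_tension_le[OF assms v])
  then have "W \<ge> 0" by (rule order_trans[OF norm_ge_zero])
  have y1: "norm (\<chi> e. - stiffness c \<theta> e * tension u $ e) \<le> norm a * (bT * (U * d))"
  proof -
    have "norm (\<chi> e. - stiffness c \<theta> e * tension u $ e) \<le> norm a * norm (tension u)"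
      using stiffness_abs_le[OF assms] by (intro norm_weighted_le) auto
    also have "\<dots> \<le> norm a * (bT * norm u)"
      by (intro mult_left_mono norm_tension_le) auto
    also have "\<dots> \<le> norm a * (bT * (U * d))"
      by (intro mult_left_mono u bT_nonneg) auto
    finally show ?thesis .
  qed
  have y2: "norm (\<chi> e. (stiffness c \<phi> e - stiffness c \<theta> e) * tension v $ e) \<le> norm a * (bT * d) * W"
  proof -
    have "\<bar>stiffness c \<phi> e - stiffness c \<theta> e\<bar> \<le> norm a * (bT * d)" for e
    proof -
      have "\<bar>tension (\<theta> - \<phi>) $ e\<bar> \<le> bT * d"
        unfolding d_def by (rule order_trans[OF component_le_norm_cart norm_tension_le])
      then have "norm a * \<bar>tension (\<theta> - \<phi>) $ e\<bar> \<le> norm a * (bT * d)"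
        by (intro mult_left_mono) auto
      then show ?thesis using stiffness_lipschitz[of c \<theta> e \<phi>] by (simp add: abs_minus_commute)
    qed
    then have "norm (\<chi> e. (stiffness c \<phi> e - stiffness c \<theta> e) * tension v $ e)
        \<le> norm a * (bT * d) * norm (tension v)"
      by (rule norm_weighted_le)
    also have "\<dots> \<le> norm a * (bT * d) * W"
      using bT_nonneg \<open>norm (tension v) \<le> W\<close> by (intro mult_left_mono) (auto simp: d_def)
    finally show ?thesis .
  qed
  have y: "norm y \<le> norm a * bT * (U + W) * d"
    using norm_triangle_le[OF add_mono[OF y1 y2]] by (simp add: y_def algebra_simps)
  have h0: "h $ i = 0" if "i \<in> I" for i
    using is_velocity_drive[OF w that] is_velocity_drive[OF v that] by (simp add: h_def u_def drive_diff)
  have "norm (tension h) \<le> norm y / (c * \<alpha>)"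
  proof (rule load_response_le[OF h0 \<open>0 < c\<close> stiffness_ge])
    have "(\<chi> e. stiffness c \<theta> e * tension h $ e) =
        (\<chi> e. stiffness c \<theta> e * tension w $ e) - (\<chi> e. stiffness c \<phi> e * tension v $ e) + y"
      by (simp add: y_def h_def vec_eq_iff tension_diff right_diff_distrib left_diff_distrib)
    then show "(B *v (\<chi> e. stiffness c \<theta> e * tension h $ e)) $ i = (B *v y) $ i" if "i \<notin> I" for i
      using w v that
      by (simp add: matrix_vector_right_distrib matrix_vector_mult_diff_distrib is_velocity_def)
  qed
  also have "\<dots> \<le> norm a * bT * (U + W) * d / (c * \<alpha>)"
    using ca y by (intro divide_right_mono) auto
  finally have "norm h * \<kappa> \<le> norm a * bT * (U + W) * d / (c * \<alpha>)"
    using load_poincare[OF h0] by (simp add: mult.commute)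
  then have "norm h \<le> norm a * bT * (U + W) * d / (c * \<alpha>) / \<kappa>"
    using \<kappa>_pos by (subst pos_le_divide_eq)
  moreover have "w - v = h + u" by (simp add: h_def)
  ultimately show "norm (w - v) \<le> (norm a * bT * (U + W) / (c * \<alpha>) / \<kappa> + U) * d"
    using norm_triangle_ineq[of h u] u by (simp add: algebra_simps)
qed

lemma regularized_motion_exists:
  assumes "0 < c" "c \<le> 1"
  obtains \<phi> where "\<phi> 0 = \<phi>0"
    "\<And>t. t \<ge> 0 \<Longrightarrow> (\<phi> has_vector_derivative velocity c (\<phi> t)) (at t within {0..})"
proof -
  obtain L where "\<And>\<theta> \<phi>. norm (velocity c \<theta> - velocity c \<phi>) \<le> L * norm (\<theta> - \<phi>)"
    using velocity_lipschitz[OF assms] by blast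
  then show ?thesis
    by (rule global_lipschitz_ode_solution) (rule that)
qed

section \<open>Energy decay near an equilibrium\<close>

definition "flow_rate \<theta> w = B *v (\<chi> e. a $ e * cos (tension \<theta> $ e) * tension w $ e)"

lemma residual_has_derivative:
  assumes "(\<theta> has_vector_derivative w) (at t within S)"
  shows "((\<lambda>t. residual (\<theta> t) $ i) has_real_derivative - flow_rate (\<theta> t) w $ i) (at t within S)"
proof -
  have "((\<lambda>t. tension (\<theta> t) $ e) has_real_derivative tension w $ e) (at t within S)" for e
    using bounded_linear.has_vector_derivative[OF
        bounded_linear_compose[OF bounded_linear_vec_nth bounded_linear_tension] assms]
    by (simp add: has_real_derivative_iff_has_vector_derivative)
  note [derivative_intros] = this
  show ?thesis
    unfolding residual_def injection_def flow_rate_def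
    by (auto intro!: derivative_eq_intros
        simp: matrix_vector_mult_def sum_negf[symmetric] mult_ac)
qed

text \<open>Along a motion the residual at an inverter is \<open>D i\<close> times the
  drift-corrected velocity, so this is also the \<open>D\<close>-weighted square sum of these
  velocities.\<close>

definition "energy \<theta> = (\<Sum>i\<in>I. (residual \<theta> $ i)\<^sup>2 / D i)"

abbreviation "Dsum \<equiv> sum D I"

lemma D_le: "i \<in> I \<Longrightarrow> D i \<le> Dsum"
  by (rule member_le_sum) (auto intro: less_imp_le D_pos)

lemma sum_inverters_le: "(\<Sum>i\<in>I. (x $ i)\<^sup>2) \<le> (norm x)\<^sup>2" for x :: "real^'n"
  by (auto simp: power2_norm_vec intro!: sum_mono2)

lemma norm_residual_le_energy:
  assumes "\<And>i. i \<notin> I \<Longrightarrow> residual \<theta> $ i = 0"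
  shows "(norm (residual \<theta>))\<^sup>2 \<le> Dsum * energy \<theta>"
proof -
  have "(norm (residual \<theta>))\<^sup>2 = (\<Sum>i\<in>I. (residual \<theta> $ i)\<^sup>2)"
    using assms
    by (auto simp: power2_norm_vec intro!: sum.mono_neutral_right)
  also have "\<dots> \<le> (\<Sum>i\<in>I. Dsum * ((residual \<theta> $ i)\<^sup>2 / D i))"
  proof (rule sum_mono)
    fix i assume "i \<in> I"
    then show "(residual \<theta> $ i)\<^sup>2 \<le> Dsum * ((residual \<theta> $ i)\<^sup>2 / D i)"
      using D_pos[of i] mult_right_mono[OF D_le, of i "(residual \<theta> $ i)\<^sup>2"]
      by (simp add: pos_le_divide_eq mult.commute)
  qed
  finally show ?thesis by (simp add: energy_def sum_distrib_left)
qed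

lemma energy_le: "energy \<theta> \<le> bD * (norm (residual \<theta>))\<^sup>2"
proof -
  have "energy \<theta> \<le> (\<Sum>i\<in>I. bD * (residual \<theta> $ i)\<^sup>2)"
    unfolding energy_def
  proof (rule sum_mono)
    fix i assume "i \<in> I"
    then show "(residual \<theta> $ i)\<^sup>2 / D i \<le> bD * (residual \<theta> $ i)\<^sup>2"
      using mult_right_mono[OF inverse_D_le, of i "(residual \<theta> $ i)\<^sup>2"] by simp
  qed
  also have "\<dots> \<le> bD * (norm (residual \<theta>))\<^sup>2"
    by (simp add: bD_nonneg mult_left_mono sum_inverters_le flip: sum_distrib_left)
  finally show ?thesis .
qed

text \<open>
  \<open>s\<close> is the common drift imposed by the secondary controller. The load condition is
  required only near \<open>\<theta>\<^sub>1\<close>, so that solutions of the regularized system are covered as well.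
\<close>

definition "droop_motion c \<epsilon> \<theta>1 \<theta> \<theta>' s \<longleftrightarrow>
  injection \<theta>1 = P \<and>
  (\<forall>e x. a $ e \<noteq> 0 \<longrightarrow> \<bar>x - tension \<theta>1 $ e\<bar> \<le> \<epsilon> \<longrightarrow> c \<le> cos x) \<and>
  (\<forall>t\<ge>0. (\<theta> has_vector_derivative \<theta>' t) (at t within {0..})) \<and>
  (\<forall>t\<ge>0. \<forall>i\<in>I. D i * (\<theta>' t $ i + s t) = residual (\<theta> t) $ i) \<and>
  (\<forall>i. i \<notin> I \<longrightarrow> residual (\<theta> 0) $ i = 0) \<and>
  (\<forall>t>0. norm (tension (\<theta> t - \<theta>1)) \<le> \<epsilon> \<longrightarrow> (\<forall>i. i \<notin> I \<longrightarrow> flow_rate (\<theta> t) (\<theta>' t) $ i = 0))"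

text \<open>Strong monotonicity of sine on each line is tested with
  \<open>\<theta> - \<theta>1\<close>. Summed over the lines, this is the inner product of minus the
  residual with \<open>\<theta> - \<theta>1\<close>, from which any constant vector may be
  subtracted because the residuals sum to 0. Cauchy-Schwarz and \<open>obtain_rotation\<close>
  finish.\<close>

lemma residual_ge:
  assumes "injection \<theta>1 = P" "c > 0"
    and cos: "\<And>e x. a $ e \<noteq> 0 \<Longrightarrow> \<bar>x - tension \<theta>1 $ e\<bar> \<le> \<epsilon> \<Longrightarrow> c \<le> cos x"
    and near: "norm (tension (\<theta> - \<theta>1)) \<le> \<epsilon>"
  shows "c * \<alpha> * \<kappa> * norm (tension (\<theta> - \<theta>1)) \<le> norm (residual \<theta>)"
proof -
  define y where "y = tension (\<theta> - \<theta>1)"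
  obtain \<gamma> where \<gamma>: "\<kappa> * norm (\<theta> - \<theta>1 - vec \<gamma>) \<le> norm y"
    unfolding y_def by (rule obtain_rotation)
  have "c * \<alpha> * (y $ e)\<^sup>2 \<le> a $ e * (sin (tension \<theta> $ e) - sin (tension \<theta>1 $ e)) * y $ e" for e
  proof (cases "a $ e = 0")
    case True
    then show ?thesis using tension_eq_0[of e "\<theta> - \<theta>1"] by (simp add: y_def)
  next
    case False
    have "c * \<alpha> * (y $ e)\<^sup>2 \<le> c * a $ e * (y $ e)\<^sup>2"
      using \<alpha>_le[OF False] \<open>c > 0\<close> by (intro mult_right_mono mult_left_mono) auto
    also have "\<dots> = a $ e * (c * (tension \<theta> $ e - tension \<theta>1 $ e)\<^sup>2)"
      by (simp add: y_def tension_diff)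
    also have "\<dots> \<le> a $ e * ((sin (tension \<theta> $ e) - sin (tension \<theta>1 $ e)) * (tension \<theta> $ e - tension \<theta>1 $ e))"
    proof (intro mult_left_mono sin_diff_mult_ge a_nonneg)
      fix z assume z: "\<bar>z - tension \<theta>1 $ e\<bar> \<le> \<bar>tension \<theta> $ e - tension \<theta>1 $ e\<bar>"
      have "\<bar>tension \<theta> $ e - tension \<theta>1 $ e\<bar> \<le> \<epsilon>"
        using order_trans[OF component_le_norm_cart[of y e] near[folded y_def]]
        by (simp add: y_def tension_diff)
      with z show "c \<le> cos z" by (intro cos[OF False]) auto
    qed
    also have "\<dots> = a $ e * (sin (tension \<theta> $ e) - sin (tension \<theta>1 $ e)) * y $ e"
      by (simp add: y_def tension_diff)
    finally show ?thesis .
  qed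
  then have "(\<Sum>e\<in>UNIV. c * \<alpha> * (y $ e)\<^sup>2)
      \<le> (\<Sum>e\<in>UNIV. a $ e * (sin (tension \<theta> $ e) - sin (tension \<theta>1 $ e)) * y $ e)"
    by (rule sum_mono)
  also have "(\<Sum>e\<in>UNIV. c * \<alpha> * (y $ e)\<^sup>2) = c * \<alpha> * (norm y)\<^sup>2"
    by (simp add: power2_norm_vec sum_distrib_left)
  also have "(\<Sum>e\<in>UNIV. a $ e * (sin (tension \<theta> $ e) - sin (tension \<theta>1 $ e)) * y $ e)
      = ((\<chi> e. a $ e * sin (tension \<theta> $ e)) - (\<chi> e. a $ e * sin (tension \<theta>1 $ e))) \<bullet> y"
    by (simp add: inner_vec_def algebra_simps)
  also have "\<dots> = (injection \<theta> - injection \<theta>1) \<bullet> (\<theta> - \<theta>1)"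
    by (simp add: injection_def y_def inner_B flip: matrix_vector_mult_diff_distrib)
  also have "\<dots> = - (residual \<theta> \<bullet> (\<theta> - \<theta>1 - vec \<gamma>))"
    using assms(1) residual_inner_vec[of \<theta> \<gamma>]
    by (simp add: residual_def inner_diff_left inner_diff_right)
  also have "\<dots> \<le> norm (residual \<theta>) * norm (\<theta> - \<theta>1 - vec \<gamma>)"
    using norm_cauchy_schwarz[of "- residual \<theta>" "\<theta> - \<theta>1 - vec \<gamma>"] by simp
  also have "\<dots> \<le> norm (residual \<theta>) * (norm y / \<kappa>)"
    using \<gamma> \<kappa>_pos by (intro mult_left_mono) (auto simp: field_simps)
  finally have "norm y * (c * \<alpha> * \<kappa> * norm y) \<le> norm y * norm (residual \<theta>)"
    using \<kappa>_pos by (simp add: power2_eq_square field_simps)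
  then show ?thesis
    by (cases "y = 0") (auto simp: y_def mult_le_cancel_left)
qed

text \<open>The factor 2 comes from differentiating squares, \<open>c * \<alpha>\<close> from
  coercivity, \<open>\<kappa>\<close> squared from the Poincare inequality, and \<open>Dsum\<close>
  from comparing the energy with the squared norm of the velocity.\<close>

definition "decay_rate c = 2 * c * \<alpha> * \<kappa>\<^sup>2 / Dsum"

lemma energy_decay:
  assumes m: "droop_motion c \<epsilon> \<theta>1 \<theta> \<theta>' s" and "c > 0" "T \<ge> 0"
    and near: "\<And>t. t \<in> {0..T} \<Longrightarrow> norm (tension (\<theta> t - \<theta>1)) \<le> \<epsilon>"
  shows "i \<notin> I \<Longrightarrow> residual (\<theta> T) $ i = 0"
    and "energy (\<theta> T) \<le> exp (- decay_rate c * T) * energy (\<theta> 0)"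
proof -
  have der: "(\<theta> has_vector_derivative \<theta>' t) (at t within {0..})" if "t \<ge> 0" for t
    using m that by (simp add: droop_motion_def)
  have der_at: "((\<lambda>t. residual (\<theta> t) $ i) has_real_derivative - flow_rate (\<theta> t) (\<theta>' t) $ i) (at t)"
    if "t > 0" for t i
  proof -
    have "at t within {0..} = at t" using that by (intro at_within_interior) auto
    with residual_has_derivative[OF der[of t]] that show ?thesis by simp
  qed
  have cont: "continuous_on {0..t} (\<lambda>t. residual (\<theta> t) $ i)" for i t
    by (intro DERIV_continuous_on[where D = "\<lambda>t. - flow_rate (\<theta> t) (\<theta>' t) $ i"]
        DERIV_subset[OF residual_has_derivative[OF der]]) auto
  have load_rate: "flow_rate (\<theta> t) (\<theta>' t) $ i = 0" if "0 < t" "t \<le> T" "i \<notin> I" for t i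
    using m near[of t] that by (simp add: droop_motion_def)
  \<comment> \<open>The load equations hold at time 0 and their residuals have derivative 0 while
    the motion is near \<open>\<theta>1\<close>. For the regularized system this is what propagates
    them.\<close>
  have load: "residual (\<theta> t) $ i = 0" if "0 \<le> t" "t \<le> T" "i \<notin> I" for t i
  proof (cases "t = 0")
    case True
    then show ?thesis using m that by (simp add: droop_motion_def)
  next
    case False
    have "residual (\<theta> t) $ i = residual (\<theta> 0) $ i"
    proof (rule DERIV_isconst_end[of 0 t "\<lambda>t. residual (\<theta> t) $ i"])
      show "((\<lambda>t. residual (\<theta> t) $ i) has_real_derivative 0) (at x)" if "0 < x" "x < t" for x
        using der_at[of x i] load_rate[of x i] that \<open>t \<le> T\<close> \<open>i \<notin> I\<close> by simp
    qed (use False that cont in auto)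
    then show ?thesis using m that by (simp add: droop_motion_def)
  qed
  then show "i \<notin> I \<Longrightarrow> residual (\<theta> T) $ i = 0" using \<open>T \<ge> 0\<close> by simp
  show "energy (\<theta> T) \<le> exp (- decay_rate c * T) * energy (\<theta> 0)"
  proof (rule exp_decay_of_derivative_bound[of T "\<lambda>t. energy (\<theta> t)"])
    show "continuous_on {0..T} (\<lambda>t. energy (\<theta> t))"
      unfolding energy_def using D_pos by (intro continuous_intros cont) force
    fix t assume t: "0 < t" "t < T"
    define q where "q = flow_rate (\<theta> t) (\<theta>' t)"
    \<comment> \<open>The common drift has no tension, so adding it leaves the flow rate unchanged,
      while it makes \<open>D i * w $ i\<close> equal to the residual at each inverter.\<close>
    define w where "w = \<theta>' t + vec (s t)"
    have w: "D i * w $ i = residual (\<theta> t) $ i" if "i \<in> I" for i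
      using m t that by (simp add: droop_motion_def w_def)
    show "((\<lambda>t. energy (\<theta> t)) has_real_derivative - 2 * (q \<bullet> w)) (at t)"
    proof -
      have "((\<lambda>t. energy (\<theta> t)) has_real_derivative
          (\<Sum>i\<in>I. 2 * residual (\<theta> t) $ i * (- q $ i) / D i)) (at t)"
        unfolding energy_def q_def using t
        by (auto intro!: derivative_eq_intros der_at sum.cong simp: D_nonzero field_simps)
      also have "(\<Sum>i\<in>I. 2 * residual (\<theta> t) $ i * (- q $ i) / D i) = (\<Sum>i\<in>I. - 2 * (q $ i * w $ i))"
        by (intro sum.cong) (auto simp: D_nonzero simp flip: w)
      \<comment> \<open>The flow rate vanishes at the loads, so the sum extends to all nodes and
        becomes a Dirichlet form of \<open>w\<close>, load velocities included.\<close>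
      also have "\<dots> = (\<Sum>i\<in>UNIV. - 2 * (q $ i * w $ i))"
        using t load_rate[of t] by (intro sum.mono_neutral_left) (auto simp: q_def)
      also have "\<dots> = - 2 * (q \<bullet> w)" by (simp add: inner_vec_def sum_distrib_left)
      finally show ?thesis .
    qed
    have "q \<bullet> w = (\<chi> e. (a $ e * cos (tension (\<theta> t) $ e)) * tension w $ e) \<bullet> tension w"
      by (simp add: q_def flow_rate_def inner_B w_def)
    moreover have "c * a $ e \<le> a $ e * cos (tension (\<theta> t) $ e)" for e
    proof (cases "a $ e = 0")
      case False
      have "\<bar>tension (\<theta> t) $ e - tension \<theta>1 $ e\<bar> \<le> \<epsilon>"
        using order_trans[OF component_le_norm_cart near[of t], of e] t by (simp add: tension_diff)
      with m False have "c \<le> cos (tension (\<theta> t) $ e)" by (auto simp: droop_motion_def)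
      from mult_left_mono[OF this a_nonneg[of e]] show ?thesis by (simp add: mult.commute)
    qed simp
    ultimately have "c * \<alpha> * (norm (tension w))\<^sup>2 \<le> q \<bullet> w"
      using weighted_tension_ge[of c] \<open>c > 0\<close> by simp
    \<comment> \<open>Load residuals being 0, the inverter residuals carry the whole sum, which
      vanishes; hence \<open>poincare\<close> applies to \<open>w\<close>.\<close>
    moreover have "(\<Sum>i\<in>I. D i * w $ i) = 0"
    proof -
      have "(\<Sum>i\<in>I. D i * w $ i) = (\<Sum>i\<in>I. residual (\<theta> t) $ i)"
        by (intro sum.cong refl w)
      also have "\<dots> = (\<Sum>i\<in>UNIV. residual (\<theta> t) $ i)"
        using load[of t] t by (intro sum.mono_neutral_left) auto
      finally show ?thesis by (simp add: residual_sum)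
    qed
    then have "(\<kappa> * norm w)\<^sup>2 \<le> (norm (tension w))\<^sup>2"
      using \<kappa>_pos by (intro power_mono poincare) auto
    then have "c * \<alpha> * (\<kappa> * norm w)\<^sup>2 \<le> c * \<alpha> * (norm (tension w))\<^sup>2"
      using \<open>c > 0\<close> \<alpha>_pos by (intro mult_left_mono) auto
    ultimately have 1: "c * \<alpha> * \<kappa>\<^sup>2 * (norm w)\<^sup>2 \<le> q \<bullet> w"
      by (simp add: power_mult_distrib mult.assoc)
    have "energy (\<theta> t) = (\<Sum>i\<in>I. D i * (w $ i)\<^sup>2)"
      unfolding energy_def using D_pos
      by (intro sum.cong) (auto simp: power2_eq_square field_simps simp flip: w)
    also have "\<dots> \<le> (\<Sum>i\<in>I. Dsum * (w $ i)\<^sup>2)"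
      by (intro sum_mono mult_right_mono D_le) auto
    also have "\<dots> \<le> Dsum * (norm w)\<^sup>2"
      using sum_D_pos by (simp add: mult_left_mono sum_inverters_le flip: sum_distrib_left)
    finally have "decay_rate c * energy (\<theta> t) \<le> decay_rate c * (Dsum * (norm w)\<^sup>2)"
      using \<open>c > 0\<close> \<alpha>_pos sum_D_pos by (intro mult_left_mono) (auto simp: decay_rate_def)
    also have "\<dots> = 2 * (c * \<alpha> * \<kappa>\<^sup>2 * (norm w)\<^sup>2)"
      using sum_D_pos by (simp add: decay_rate_def)
    finally show "- 2 * (q \<bullet> w) \<le> - decay_rate c * energy (\<theta> t)" using 1 by simp
  qed (use \<open>T \<ge> 0\<close> in auto)
qed

text \<open>The constants are fixed before \<open>\<theta>1\<close>, the motion and the drift, so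
  that one choice serves a whole orbit and every controller transient.\<close>

lemma droop_motion_stable:
  assumes "c > 0" "\<epsilon> > 0"
  obtains \<delta> K r where "\<delta> > 0" "K > 0" "r > 0"
    "\<And>\<theta>1 \<theta> \<theta>' s t. droop_motion c \<epsilon> \<theta>1 \<theta> \<theta>' s \<Longrightarrow> norm (\<theta> 0 - \<theta>1) < \<delta> \<Longrightarrow> t \<ge> 0 \<Longrightarrow>
       norm (tension (\<theta> t - \<theta>1)) < \<epsilon> \<and> (\<forall>i. i \<notin> I \<longrightarrow> residual (\<theta> t) $ i = 0) \<and>
       (\<exists>\<gamma>. norm (\<theta> t - \<theta>1 - vec \<gamma>) \<le> K * exp (- r * t) * norm (\<theta> 0 - \<theta>1))"
proof
  define \<mu> where "\<mu> = c * \<alpha> * \<kappa>"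
  \<comment> \<open>The initial residual is bounded by the Lipschitz constant of the injections,
    energy decay costs the square root, and \<open>residual_ge\<close> divides by
    \<open>\<mu>\<close>; adding 1 keeps \<open>K\<close> positive. The rate \<open>r\<close> is
    half that of the energy, which is quadratic. The choice of \<open>\<delta>\<close> keeps the
    tension below \<open>\<epsilon>\<close> both at time 0 (through \<open>bT\<close>) and later
    (through \<open>K\<close>).\<close>
  define K where "K = sqrt (Dsum * bD) * (bB * norm a * bT) / \<mu> + 1"
  define r where "r = decay_rate c / 2"
  define \<delta> where "\<delta> = \<epsilon> / (K + bT + 1)"
  have \<mu>: "\<mu> > 0" using assms \<alpha>_pos \<kappa>_pos by (simp add: \<mu>_def)
  have K: "K > 0"
    using \<mu> bB_nonneg bT_nonneg sum_D_pos bD_nonneg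
    by (auto simp: K_def intro!: add_nonneg_pos divide_nonneg_pos mult_nonneg_nonneg)
  show "\<delta> > 0" using K bT_nonneg \<open>\<epsilon> > 0\<close> by (simp add: \<delta>_def)
  show "K / \<kappa> > 0" using K \<kappa>_pos by simp
  show r: "r > 0" using assms \<alpha>_pos \<kappa>_pos sum_D_pos by (simp add: r_def decay_rate_def)
  fix \<theta>1 \<theta> \<theta>' s and t :: real
  assume m: "droop_motion c \<epsilon> \<theta>1 \<theta> \<theta>' s" and d: "norm (\<theta> 0 - \<theta>1) < \<delta>" and "t \<ge> 0"
  define d where "d = norm (\<theta> 0 - \<theta>1)"
  have "d \<ge> 0" by (simp add: d_def)
  have "(K + bT + 1) * d < \<epsilon>"
    using d K bT_nonneg by (simp add: \<delta>_def d_def pos_less_divide_eq mult.commute)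
  then have Kd: "K * d < \<epsilon>" "bT * d < \<epsilon>"
    using \<open>d \<ge> 0\<close> K bT_nonneg mult_nonneg_nonneg[of K d] mult_nonneg_nonneg[of bT d]
    by (simp_all add: distrib_right del: mult_nonneg_nonneg)
  have decay: "norm (tension (\<theta> T - \<theta>1)) \<le> K * exp (- r * T) * d"
    if "T \<ge> 0" and near: "\<And>t. t \<in> {0..T} \<Longrightarrow> norm (tension (\<theta> t - \<theta>1)) \<le> \<epsilon>" for T
  proof -
    note E = energy_decay[OF m \<open>c > 0\<close> that]
    have res0: "norm (residual (\<theta> 0)) \<le> bB * norm a * bT * d"
      using injection_lipschitz[of "\<theta> 0" \<theta>1] m
      by (simp add: d_def residual_def droop_motion_def norm_minus_commute)
    have "(norm (residual (\<theta> T)))\<^sup>2 \<le> Dsum * energy (\<theta> T)"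
      by (rule norm_residual_le_energy) (rule E(1))
    also have "\<dots> \<le> Dsum * (exp (- decay_rate c * T) * (bD * (norm (residual (\<theta> 0)))\<^sup>2))"
      using sum_D_pos
      by (intro mult_left_mono order_trans[OF E(2)] energy_le) auto
    also have "exp (- decay_rate c * T) = (exp (- r * T))\<^sup>2"
      by (simp add: r_def flip: exp_double)
    also have "Dsum * ((exp (- r * T))\<^sup>2 * (bD * (norm (residual (\<theta> 0)))\<^sup>2))
        = (sqrt (Dsum * bD) * exp (- r * T) * norm (residual (\<theta> 0)))\<^sup>2"
      using sum_D_pos bD_nonneg by (simp add: power_mult_distrib)
    finally have "norm (residual (\<theta> T)) \<le> sqrt (Dsum * bD) * exp (- r * T) * norm (residual (\<theta> 0))"
      by (rule power2_le_imp_le) (use sum_D_pos bD_nonneg in auto)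
    also have "\<dots> \<le> sqrt (Dsum * bD) * exp (- r * T) * (bB * norm a * bT * d)"
      using sum_D_pos bD_nonneg by (intro mult_left_mono res0) auto
    finally have *: "norm (residual (\<theta> T)) \<le> sqrt (Dsum * bD) * (bB * norm a * bT) * exp (- r * T) * d"
      by (simp add: mult_ac)
    have "\<mu> * norm (tension (\<theta> T - \<theta>1)) \<le> norm (residual (\<theta> T))"
      unfolding \<mu>_def using m that
      by (intro residual_ge[where \<epsilon> = \<epsilon>] \<open>c > 0\<close>) (auto simp: droop_motion_def)
    then have "norm (tension (\<theta> T - \<theta>1)) \<le> norm (residual (\<theta> T)) / \<mu>"
      using \<mu> by (simp add: pos_le_divide_eq mult.commute)
    also have "\<dots> \<le> sqrt (Dsum * bD) * (bB * norm a * bT) * exp (- r * T) * d / \<mu>"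
      using \<mu> * by (intro divide_right_mono) auto
    also have "\<dots> \<le> K * exp (- r * T) * d"
      using \<open>d \<ge> 0\<close> by (simp add: K_def algebra_simps)
    finally show ?thesis .
  qed
  have near: "norm (tension (\<theta> t - \<theta>1)) < \<epsilon>" if "t \<ge> 0" for t
  proof (rule bootstrap_less[where m = "\<lambda>t. norm (tension (\<theta> t - \<theta>1))", OF _ _ _ that])
    have "continuous_on {0..} \<theta>"
      using m by (auto simp: droop_motion_def continuous_on_eq_continuous_within
          intro: has_vector_derivative_continuous)
    then show "continuous_on {0..} (\<lambda>t. norm (tension (\<theta> t - \<theta>1)))"
      by (intro continuous_intros bounded_linear.continuous_on[OF bounded_linear_tension])
    show "norm (tension (\<theta> 0 - \<theta>1)) < \<epsilon>"
      using order.strict_trans1[OF norm_tension_le Kd(2)[unfolded d_def]] .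
    fix T :: real assume T: "T \<ge> 0" "\<And>t. t \<in> {0..T} \<Longrightarrow> norm (tension (\<theta> t - \<theta>1)) \<le> \<epsilon>"
    have "norm (tension (\<theta> T - \<theta>1)) \<le> K * exp (- r * T) * d" by (rule decay[OF T])
    also have "\<dots> \<le> K * 1 * d"
      using K T(1) \<open>d \<ge> 0\<close> r by (intro mult_right_mono mult_left_mono) auto
    finally show "norm (tension (\<theta> T - \<theta>1)) < \<epsilon>" using Kd by simp
  qed
  then have le: "norm (tension (\<theta> u - \<theta>1)) \<le> \<epsilon>" if "u \<in> {0..t}" for u
    using that by (simp add: less_imp_le)
  obtain \<gamma> where "\<kappa> * norm (\<theta> t - \<theta>1 - vec \<gamma>) \<le> norm (tension (\<theta> t - \<theta>1))"
    by (rule obtain_rotation)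
  also have "\<dots> \<le> K * exp (- r * t) * d"
    by (rule decay[OF \<open>t \<ge> 0\<close> le])
  finally have "norm (\<theta> t - \<theta>1 - vec \<gamma>) \<le> K / \<kappa> * exp (- r * t) * d"
    using \<kappa>_pos by (simp add: field_simps)
  with near[OF \<open>t \<ge> 0\<close>] energy_decay(1)[OF m \<open>c > 0\<close> \<open>t \<ge> 0\<close> le]
  show "norm (tension (\<theta> t - \<theta>1)) < \<epsilon> \<and> (\<forall>i. i \<notin> I \<longrightarrow> residual (\<theta> t) $ i = 0) \<and>
       (\<exists>\<gamma>. norm (\<theta> t - \<theta>1 - vec \<gamma>) \<le> K / \<kappa> * exp (- r * t) * norm (\<theta> 0 - \<theta>1))"
    by (auto simp: d_def)
qed

section \<open>Existence of motions\<close>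

lemma residual_add_vec [simp]: "residual (\<theta> + vec c) = residual \<theta>"
  by (simp add: residual_def injection_def)

text \<open>Tensions and residuals ignore common rotations, so the drift can be added to a finished
  solution of the regularized system. Near \<open>\<theta>1\<close> the cosines are at least
  \<open>c\<close>, hence the regularized coefficients are the true ones.\<close>

lemma droop_motion_exists:
  assumes "0 < c" "c \<le> 1" "k > 0" "injection \<theta>1 = P"
    and cos: "\<And>e x. a $ e \<noteq> 0 \<Longrightarrow> \<bar>x - tension \<theta>1 $ e\<bar> \<le> \<epsilon> \<Longrightarrow> c \<le> cos x"
    and load: "\<And>i. i \<notin> I \<Longrightarrow> residual \<theta>0 $ i = 0"
  obtains \<theta> \<theta>' where "\<theta> 0 = \<theta>0" "droop_motion c \<epsilon> \<theta>1 \<theta> \<theta>' (\<lambda>t. s0 * exp (- t / k))"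
proof -
  obtain \<phi> where \<phi>0: "\<phi> 0 = \<theta>0"
    and \<phi>: "\<And>t. t \<ge> 0 \<Longrightarrow> (\<phi> has_vector_derivative velocity c (\<phi> t)) (at t within {0..})"
    using regularized_motion_exists[OF assms(1,2)] by blast
  \<comment> \<open>The added angle is the integral of \<open>- s0 * exp (- t / k)\<close> that
    vanishes at time 0.\<close>
  define \<theta> where "\<theta> t = \<phi> t + vec (k * s0 * (exp (- t / k) - 1))" for t
  define \<theta>' where "\<theta>' t = velocity c (\<phi> t) + vec (- (s0 * exp (- t / k)))" for t
  have "(\<theta> has_vector_derivative \<theta>' t) (at t within {0..})" if "t \<ge> 0" for t
  proof -
    have "((\<lambda>t. k * s0 * (exp (- t / k) - 1)) has_vector_derivative - (s0 * exp (- t / k))) (at t within {0..})"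
      using \<open>k > 0\<close>
      by (auto intro!: derivative_eq_intros simp flip: has_real_derivative_iff_has_vector_derivative)
    moreover have "bounded_linear (vec :: real \<Rightarrow> real ^ 'n)"
      by (intro linear_conv_bounded_linear[THEN iffD1] linearI) (auto simp: vec_eq_iff)
    ultimately have "((\<lambda>t. vec (k * s0 * (exp (- t / k) - 1)) :: real ^ 'n) has_vector_derivative
        vec (- (s0 * exp (- t / k)))) (at t within {0..})"
      using bounded_linear.has_vector_derivative by blast
    then show ?thesis
      unfolding \<theta>_def \<theta>'_def by (intro has_vector_derivative_add \<phi>[OF that])
  qed
  moreover have vel: "is_velocity c (\<phi> t) (velocity c (\<phi> t))" for t
    by (rule velocity[OF \<open>0 < c\<close>])
  moreover have "flow_rate (\<theta> t) (\<theta>' t) $ i = 0"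
    if near: "norm (tension (\<theta> t - \<theta>1)) \<le> \<epsilon>" and "i \<notin> I" for t i
  proof -
    have "stiffness c (\<phi> t) e = a $ e * cos (tension (\<theta> t) $ e)" for e
    proof (cases "a $ e = 0")
      case False
      have "\<bar>tension (\<theta> t) $ e - tension \<theta>1 $ e\<bar> \<le> \<epsilon>"
        using order_trans[OF component_le_norm_cart near, of e] by (simp add: tension_diff)
      from cos[OF False this] show ?thesis by (simp add: stiffness_def \<theta>_def max_absorb2)
    qed (simp add: stiffness_def)
    then show ?thesis
      using vel[of t] \<open>i \<notin> I\<close> by (simp add: is_velocity_def flow_rate_def \<theta>'_def)
  qed
  ultimately have "droop_motion c \<epsilon> \<theta>1 \<theta> \<theta>' (\<lambda>t. s0 * exp (- t / k))"
    using assms cos load unfolding droop_motion_def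
    by (auto simp: \<theta>_def \<theta>'_def \<phi>0 is_velocity_def)
  moreover have "\<theta> 0 = \<theta>0" by (simp add: \<theta>_def \<phi>0)
  ultimately show ?thesis using that by blast
qed

end

section \<open>Acyclic graphs and power flow\<close>

text \<open>The first node of a longest path has a neighbour other than the second node. By
  maximality it lies on the path, at index 2 or later, and the segment up to it closes to a
  cycle.\<close>

lemma cycle_of_min_degree_2:
  fixes R :: "'a::finite \<Rightarrow> 'a \<Rightarrow> bool"
  assumes sym: "\<And>i j. R i j \<Longrightarrow> R j i" and irrefl: "\<And>i. \<not> R i i"
    and degree: "\<And>i j. R i j \<Longrightarrow> \<exists>k. k \<noteq> j \<and> R i k" and "R i0 j0"
  obtains c where "3 \<le> length c" "distinct c" "\<And>l. l < length c \<Longrightarrow> R (c ! l) (c ! (Suc l mod length c))"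
proof -
  define path where
    "path p \<longleftrightarrow> 2 \<le> length p \<and> distinct p \<and> (\<forall>l. Suc l < length p \<longrightarrow> R (p ! l) (p ! Suc l))" for p
  have "path [i0, j0]"
    using \<open>R i0 j0\<close> irrefl by (auto simp: path_def)
  moreover have "length p < Suc (card (UNIV :: 'a set))" if "path p" for p
    using that by (simp add: path_def less_Suc_eq_le card_mono flip: distinct_card)
  ultimately obtain p where p: "path p" and longest: "\<And>q. path q \<Longrightarrow> length q \<le> length p"
    using ex_has_greatest_nat[of path "[i0, j0]" length] by blast
  then have "R (p ! 0) (p ! 1)" by (auto simp: path_def)
  then obtain k where k: "k \<noteq> p ! 1" "R (p ! 0) k" using degree by blast
  have "k \<in> set p"
  proof (rule ccontr)
    assume "k \<notin> set p"
    moreover have "R ((k # p) ! l) ((k # p) ! Suc l)" if "l < length p" for l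
      using p that sym[OF k(2)] by (cases l) (auto simp: path_def)
    ultimately have "path (k # p)" using p by (auto simp: path_def)
    then show False using longest by force
  qed
  then obtain m where m: "m < length p" "p ! m = k" by (auto simp: in_set_conv_nth)
  have "m \<noteq> 0" using k(2) irrefl m by metis
  moreover have "m \<noteq> 1" using k(1) m by metis
  ultimately have "2 \<le> m" by simp
  show ?thesis
  proof (rule that[of "take (Suc m) p"])
    show "3 \<le> length (take (Suc m) p)" "distinct (take (Suc m) p)"
      using m \<open>2 \<le> m\<close> p by (auto simp: path_def)
    fix l assume "l < length (take (Suc m) p)"
    then have "l \<le> m" using m by simp
    show "R (take (Suc m) p ! l) (take (Suc m) p ! (Suc l mod length (take (Suc m) p)))"
    proof (cases "l = m")
      case True
      then show ?thesis using m sym[OF k(2)] by (simp add: min_absorb2)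
    next
      case False
      then show ?thesis using m \<open>l \<le> m\<close> p by (simp add: min_absorb2 path_def)
    qed
  qed
qed

text \<open>Fredholm alternative: the component of \<open>b\<close> orthogonal to the range lies in
  the kernel of the transpose, hence is orthogonal to \<open>b\<close> and so to itself.\<close>

lemma matrix_range_orthogonal_kernel:
  fixes A :: "real ^ 'n ^ 'm"
  assumes "\<And>y. transpose A *v y = 0 \<Longrightarrow> b \<bullet> y = 0"
  obtains x where "A *v x = b"
proof -
  have sub: "subspace (range ((*v) A))"
    by (intro linear_subspace_image) auto
  obtain y z where yz: "y \<in> span (range ((*v) A))" "b = y + z"
    and orth: "\<And>w. w \<in> span (range ((*v) A)) \<Longrightarrow> orthogonal z w"
    using orthogonal_subspace_decomp_exists[of "range ((*v) A)" b] by metis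
  have "(transpose A *v z) \<bullet> x = 0" for x
    using orth[of "A *v x"]
    by (simp add: span_base orthogonal_def dot_lmul_matrix)
  then have "transpose A *v z = 0" by (metis inner_eq_zero_iff)
  then have "b \<bullet> z = 0" by (rule assms)
  moreover have "y \<bullet> z = 0" using orth[OF yz(1)] by (simp add: orthogonal_def inner_commute)
  ultimately have "z = 0" using yz(2) by (simp add: inner_add_left)
  with yz sub that show ?thesis by (auto simp: span_eq_iff[THEN iffD2])
qed

subsection \<open>Incidence matrix\<close>

lemma asym_no_loop: "asym E \<Longrightarrow> (i, i) \<notin> E"
  by (auto dest: asymD)

lemma transpose_incidence_nth:
  assumes "asym E"
  shows "(transpose (incidence E) *v \<theta>) $ (i, j) = (if (i, j) \<in> E then \<theta> $ i - \<theta> $ j else 0)"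
proof (cases "(i, j) \<in> E")
  case True
  then have "i \<noteq> j" using asym_no_loop[OF assms] by auto
  have "(transpose (incidence E) *v \<theta>) $ (i, j)
      = (\<Sum>l\<in>UNIV. (if l = i then \<theta> $ l else 0) - (if l = j then \<theta> $ l else 0))"
    unfolding matrix_vector_mult_def vec_lambda_beta
    by (rule sum.cong) (use True \<open>i \<noteq> j\<close> in \<open>simp_all add: transpose_def incidence_def\<close>)
  then show ?thesis using True by (simp add: sum_subtractf)
next
  case False
  then show ?thesis by (simp add: matrix_vector_mult_def transpose_def incidence_def)
qed

lemma incidence_mult_nth:
  assumes "asym E"
  shows "(incidence E *v f) $ i =
    (\<Sum>j\<in>UNIV. (if (i, j) \<in> E then f $ (i, j) else 0) - (if (j, i) \<in> E then f $ (j, i) else 0))"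
proof -
  have "(incidence E *v f) $ i = (\<Sum>l\<in>UNIV. \<Sum>j\<in>UNIV. incidence E $ i $ (l, j) * f $ (l, j))"
    by (simp add: matrix_vector_mult_def sum.cartesian_product UNIV_Times_UNIV)
  also have "\<dots> = (\<Sum>l\<in>UNIV. \<Sum>j\<in>UNIV. (if l = i then if (i, j) \<in> E then f $ (i, j) else 0 else 0)
      - (if j = i then if (l, i) \<in> E then f $ (l, i) else 0 else 0))"
    using asym_no_loop[OF assms] by (intro sum.cong refl) (auto simp: incidence_def)
  also have "\<dots> = (\<Sum>j\<in>UNIV. if (i, j) \<in> E then f $ (i, j) else 0)
      - (\<Sum>l\<in>UNIV. if (l, i) \<in> E then f $ (l, i) else 0)"
    unfolding sum_subtractf
    by (subst sum.swap) (simp add: sum_subtractf)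
  finally show ?thesis by (simp add: sum_subtractf)
qed

lemma transpose_incidence_in_edge_space: "transpose (incidence E) *v \<theta> \<in> edge_space E"
  by (simp add: edge_space_def matrix_vector_mult_def transpose_def incidence_def)

text \<open>The incidence matrix does not see entries outside \<open>E\<close>, so linear algebra
  can be done on the full space and its results projected to the edge space.\<close>

definition restrict_edges :: "('n \<times> 'n) set \<Rightarrow> real ^ ('n \<times> 'n) \<Rightarrow> real ^ ('n::finite \<times> 'n)" where
  "restrict_edges E f = (\<chi> e. if e \<in> E then f $ e else 0)"

lemma restrict_edges_in_edge_space: "restrict_edges E f \<in> edge_space E"
  by (simp add: restrict_edges_def edge_space_def)

lemma incidence_restrict_edges: "incidence E *v restrict_edges E f = incidence E *v f"
proof -
  have "incidence E $ i $ e * restrict_edges E f $ e = incidence E $ i $ e * f $ e" for i e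
    by (simp add: incidence_def restrict_edges_def)
  then show ?thesis unfolding matrix_vector_mult_def by presburger
qed

lemma connected_edge_invariant:
  assumes "connected_graph E" and step: "\<And>i j. (i, j) \<in> E \<Longrightarrow> Q i j"
    and "\<And>i. Q i i" "\<And>i j. Q i j \<Longrightarrow> Q j i" "\<And>i j l. Q i j \<Longrightarrow> Q j l \<Longrightarrow> Q i l"
  shows "Q i j"
proof -
  have "(adjacent E)\<^sup>*\<^sup>* i j" using assms(1) by (simp add: connected_graph_def)
  then show ?thesis
  proof (induction rule: rtranclp_induct)
    case base
    show ?case by fact
  next
    case (step j l)
    then have "Q j l" using assms(2,4) unfolding adjacent_def by blast
    with step.IH show ?case by (rule assms(5))
  qed
qed

lemma transpose_incidence_kernel:
  assumes "asym E" "connected_graph E"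
  shows "transpose (incidence E) *v \<theta> = 0 \<longleftrightarrow> (\<exists>c. \<theta> = vec c)"
proof
  assume 0: "transpose (incidence E) *v \<theta> = 0"
  have "\<theta> $ i = \<theta> $ j" for i j
  proof (rule connected_edge_invariant[OF assms(2)])
    fix i j assume "(i, j) \<in> E"
    then show "\<theta> $ i = \<theta> $ j"
      using transpose_incidence_nth[OF assms(1), of \<theta> i j] unfolding 0 by simp
  qed auto
  then have "\<theta> = vec (\<theta> $ undefined)" by (simp add: vec_eq_iff)
  then show "\<exists>c. \<theta> = vec c" by blast
next
  assume "\<exists>c. \<theta> = vec c"
  then show "transpose (incidence E) *v \<theta> = 0"
    by (auto simp: vec_eq_iff transpose_incidence_nth[OF assms(1)] simp del: transpose_matrix_vector)
qed

text \<open>By Kirchhoff's law, no node is the end of exactly one edge of the support of a circulation.\<close>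

lemma circulation_eq_0:
  assumes "asym E" "acyclic_graph E" and f: "f \<in> edge_space E" "incidence E *v f = 0"
  shows "f = 0"
proof (rule ccontr)
  assume "f \<noteq> 0"
  define R where "R i j \<longleftrightarrow> f $ (i, j) \<noteq> 0 \<or> f $ (j, i) \<noteq> 0" for i j
  have R: "adjacent E i j" if "R i j" for i j
    using that f(1) by (auto simp: R_def edge_space_def adjacent_def)
  from \<open>f \<noteq> 0\<close> obtain i0 j0 where "R i0 j0" by (auto simp: R_def vec_eq_iff)
  have "\<exists>k. k \<noteq> j \<and> R i k" if "R i j" for i j
  proof (rule ccontr)
    assume "\<nexists>k. k \<noteq> j \<and> R i k"
    then have "f $ (i, k) = 0 \<and> f $ (k, i) = 0" if "k \<noteq> j" for k
      using that by (auto simp: R_def)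
    then have "(incidence E *v f) $ i = (\<Sum>k\<in>UNIV. if k = j then
        (if (i, j) \<in> E then f $ (i, j) else 0) - (if (j, i) \<in> E then f $ (j, i) else 0) else 0)"
      unfolding incidence_mult_nth[OF assms(1)] by (intro sum.cong refl) auto
    also have "\<dots> = (if (i, j) \<in> E then f $ (i, j) else 0) - (if (j, i) \<in> E then f $ (j, i) else 0)"
      by simp
    finally show False
      using \<open>R i j\<close> f assms(1) by (auto simp: R_def edge_space_def split: if_splits dest: asymD)
  qed
  moreover have "\<not> R i i" for i
    using R[of i i] asym_no_loop[OF assms(1)] by (auto simp: adjacent_def)
  moreover have "R j i" if "R i j" for i j using that by (auto simp: R_def)
  ultimately obtain c where "3 \<le> length c" "distinct c"
    "\<And>l. l < length c \<Longrightarrow> R (c ! l) (c ! (Suc l mod length c))"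
    using cycle_of_min_degree_2[of R i0 j0] \<open>R i0 j0\<close> by blast
  then have "undirected_cycle E c" using R by (auto simp: undirected_cycle_def)
  with assms(2) show False by (auto simp: acyclic_graph_def)
qed

lemma edge_space_nth: "x \<in> edge_space E \<Longrightarrow> e \<notin> E \<Longrightarrow> x $ e = 0"
  unfolding edge_space_def by blast

lemma edge_space_diff: "x \<in> edge_space E \<Longrightarrow> y \<in> edge_space E \<Longrightarrow> x - y \<in> edge_space E"
  by (simp add: edge_space_def)

text \<open>If the Gram matrix kills a difference of edge vectors, pairing with that difference
  shows that it is a circulation, which is 0 on an acyclic graph. So the inverse on the edge space
  is a true left inverse.\<close>

lemma incidence_pinv_incidence:
  assumes "asym E" "acyclic_graph E" "f \<in> edge_space E"
  shows "incidence_pinv E (incidence E *v f) = f"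
proof -
  let ?B = "incidence E"
  have "inj_on (\<lambda>x. (transpose ?B ** ?B) *v x) (edge_space E)"
  proof (rule inj_onI)
    fix x y assume xy: "x \<in> edge_space E" "y \<in> edge_space E"
      "(transpose ?B ** ?B) *v x = (transpose ?B ** ?B) *v y"
    then have "transpose ?B *v (?B *v (x - y)) = 0"
      by (simp add: matrix_vector_mult_diff_distrib matrix_vector_mul_assoc del: transpose_matrix_vector)
    then have "(?B *v (x - y)) \<bullet> (?B *v (x - y)) = 0"
      by (metis dot_lmul_matrix inner_zero_left transpose_matrix_vector)
    then have "x - y = 0"
      using circulation_eq_0[OF assms(1,2) edge_space_diff[OF xy(1,2)]] by simp
    then show "x = y" by simp
  qed
  then show ?thesis
    using inv_into_f_f[of "\<lambda>x. (transpose ?B ** ?B) *v x" "edge_space E" f] assms(3)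
    by (simp add: incidence_pinv_def edge_inv_def matrix_vector_mul_assoc del: transpose_matrix_vector)
qed

text \<open>Fredholm alternative: on a connected graph the only obstruction is pairing with a
  constant vector.\<close>

lemma balanced_imp_incidence_range:
  assumes "asym E" "connected_graph E" "(\<Sum>i\<in>UNIV. x $ i) = 0"
  obtains f where "f \<in> edge_space E" "incidence E *v f = x"
proof -
  obtain f where "incidence E *v f = x"
  proof (rule matrix_range_orthogonal_kernel)
    fix y assume "transpose (incidence E) *v y = 0"
    then obtain c where "y = vec c" using transpose_incidence_kernel[OF assms(1,2)] by blast
    then show "x \<bullet> y = 0" using assms(3) by (simp add: inner_vec_def flip: sum_distrib_right)
  qed
  then show ?thesis
    using that[OF restrict_edges_in_edge_space] by (simp add: incidence_restrict_edges)
qed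

text \<open>The Fredholm obstruction to prescribing angle differences on the edges would be a
  nonzero circulation.\<close>

lemma transpose_incidence_surj:
  assumes "asym E" "acyclic_graph E" "x \<in> edge_space E"
  obtains \<theta> where "transpose (incidence E) *v \<theta> = x"
proof (rule matrix_range_orthogonal_kernel)
  fix y assume "transpose (transpose (incidence E)) *v y = 0"
  then have "incidence E *v restrict_edges E y = 0"
    by (simp add: incidence_restrict_edges transpose_transpose del: transpose_matrix_vector)
  then have "restrict_edges E y = 0"
    using circulation_eq_0[OF assms(1,2) restrict_edges_in_edge_space] by simp
  then have y: "restrict_edges E y $ e = 0" for e by simp
  have "x $ e * y $ e = 0" for e
  proof (cases "e \<in> E")
    case True
    then show ?thesis using y[of e] by (simp add: restrict_edges_def)
  next
    case False
    then show ?thesis using edge_space_nth[OF assms(3) False] by simp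
  qed
  then show "x \<bullet> y = 0"
    unfolding inner_vec_def inner_real_def by (intro sum.neutral) blast
qed (rule that)

subsection \<open>Angles\<close>

lemma circle_dist_le: "circle_dist x y \<le> \<bar>x - y\<bar>"
proof -
  have "circle_dist x y \<le> \<bar>x - y + 2 * pi * of_int 0\<bar>"
    unfolding circle_dist_def by (rule cINF_lower) (auto intro!: bdd_belowI[of _ 0])
  then show ?thesis by simp
qed

lemma circle_dist_lessE:
  assumes "circle_dist x y < b"
  obtains m :: int where "\<bar>x - y + 2 * pi * of_int m\<bar> < b"
proof -
  have "\<exists>m::int. \<bar>x - y + 2 * pi * of_int m\<bar> < b"
    using assms unfolding circle_dist_def
    by (subst (asm) cINF_less_iff) (auto intro!: bdd_belowI[of _ 0])
  then show ?thesis using that by blast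
qed

lemma circle_dist_shift:
  assumes "x' - y' = x - y + 2 * pi * of_int l"
  shows "circle_dist x' y' = circle_dist x y"
proof -
  have "range (\<lambda>m::int. \<bar>x' - y' + 2 * pi * of_int m\<bar>) = range (\<lambda>m::int. \<bar>x - y + 2 * pi * of_int m\<bar>)"
    (is "range ?f = range ?g")
  proof -
    have "?f m = ?g (m + l)" "?g m = ?f (m - l)" for m
      using assms by (simp_all add: algebra_simps)
    then show ?thesis by (metis (mono_tags, lifting) image_subsetI rangeI subset_antisym)
  qed
  then show ?thesis by (simp add: circle_dist_def)
qed

lemma orbit_self: "\<theta> \<in> orbit \<theta>"
  unfolding orbit_def by (auto intro!: exI[of _ 0] exI[of _ "\<lambda>_. 0"])

lemma orbit_add_vec: "\<phi> \<in> orbit \<theta> \<Longrightarrow> \<phi> + vec c \<in> orbit \<theta>"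
proof -
  assume "\<phi> \<in> orbit \<theta>"
  then obtain d m where "\<And>i. \<phi> $ i = \<theta> $ i + d + 2 * pi * of_int (m i)"
    by (auto simp: orbit_def)
  then have "\<forall>i. (\<phi> + vec c) $ i = \<theta> $ i + (d + c) + 2 * pi * of_int (m i)" by simp
  then show ?thesis unfolding orbit_def by blast
qed

lemma orbit_differences:
  assumes "\<phi> \<in> orbit \<theta>"
  obtains l :: int where "\<phi> $ i - \<phi> $ j = \<theta> $ i - \<theta> $ j + 2 * pi * of_int l"
proof -
  obtain d m where "\<And>i. \<phi> $ i = \<theta> $ i + d + 2 * pi * of_int (m i)"
    using assms by (auto simp: orbit_def)
  then have "\<phi> $ i - \<phi> $ j = \<theta> $ i - \<theta> $ j + 2 * pi * of_int (m i - m j)"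
    by (simp add: algebra_simps)
  then show ?thesis by (rule that)
qed

lemma orbit_arc_set: "\<phi> \<in> orbit \<theta> \<Longrightarrow> \<theta> \<in> arc_set E \<gamma> \<Longrightarrow> \<phi> \<in> arc_set E \<gamma>"
  unfolding arc_set_def
proof safe
  fix i j assume "\<phi> \<in> orbit \<theta>" "(i, j) \<in> E" "\<forall>(i, j)\<in>E. circle_dist (\<theta> $ i) (\<theta> $ j) \<le> \<gamma>"
  then show "circle_dist (\<phi> $ i) (\<phi> $ j) \<le> \<gamma>"
    using orbit_differences[of \<phi> \<theta> i j] circle_dist_shift by (metis case_prodD)
qed

lemma sin_add_int_2pi: "sin (x + 2 * pi * of_int l) = sin x"
  and cos_add_int_2pi: "cos (x + 2 * pi * of_int l) = cos x"
  by (simp_all add: sin_add cos_add)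

lemma P_e_orbit: "\<phi> \<in> orbit \<theta> \<Longrightarrow> P_e Y V \<phi> = P_e Y V \<theta>"
proof -
  assume "\<phi> \<in> orbit \<theta>"
  then have "sin (\<phi> $ i - \<phi> $ j) = sin (\<theta> $ i - \<theta> $ j)" for i j
    by (metis orbit_differences sin_add_int_2pi)
  then show ?thesis by (simp add: P_e_def)
qed

text \<open>Sine is injective on arcs shorter than a quarter turn, so differences along edges agree
  modulo full turns. Connectedness carries this to all pairs of nodes, and comparison with one
  reference node (\<open>undefined\<close>) gives the rotation.\<close>

lemma orbit_of_equal_sines:
  assumes "connected_graph E" "\<gamma> < pi / 2" "\<theta> \<in> arc_set E \<gamma>" "\<phi> \<in> arc_set E \<gamma>"
    and sin: "\<And>i j. (i, j) \<in> E \<Longrightarrow> sin (\<phi> $ i - \<phi> $ j) = sin (\<theta> $ i - \<theta> $ j)"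
  shows "\<phi> \<in> orbit \<theta>"
proof -
  define Q where "Q i j \<longleftrightarrow> (\<exists>l::int. \<phi> $ i - \<phi> $ j = \<theta> $ i - \<theta> $ j + 2 * pi * of_int l)" for i j
  have "Q i j" for i j
  proof (rule connected_edge_invariant[OF assms(1)])
    fix i j assume E: "(i, j) \<in> E"
    obtain l where l: "\<bar>\<phi> $ i - \<phi> $ j + 2 * pi * of_int l\<bar> < pi / 2"
      by (rule circle_dist_lessE[of "\<phi> $ i" "\<phi> $ j" "pi / 2"]) (use assms E in \<open>force simp: arc_set_def\<close>)
    obtain m where m: "\<bar>\<theta> $ i - \<theta> $ j + 2 * pi * of_int m\<bar> < pi / 2"
      by (rule circle_dist_lessE[of "\<theta> $ i" "\<theta> $ j" "pi / 2"]) (use assms E in \<open>force simp: arc_set_def\<close>)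
    have "\<phi> $ i - \<phi> $ j + 2 * pi * of_int l = \<theta> $ i - \<theta> $ j + 2 * pi * of_int m"
    proof (rule sin_inj_pi)
      show "sin (\<phi> $ i - \<phi> $ j + 2 * pi * of_int l) = sin (\<theta> $ i - \<theta> $ j + 2 * pi * of_int m)"
        unfolding sin_add_int_2pi by (rule sin[OF E])
    qed (use l m in linarith)+
    then have "\<phi> $ i - \<phi> $ j = \<theta> $ i - \<theta> $ j + 2 * pi * of_int (m - l)"
      by (simp add: algebra_simps)
    then show "Q i j" unfolding Q_def by blast
  next
    show "Q i i" for i by (auto simp: Q_def intro: exI[of _ 0])
    show "Q j i" if "Q i j" for i j
    proof -
      from that obtain l :: int where "\<phi> $ i - \<phi> $ j = \<theta> $ i - \<theta> $ j + 2 * pi * of_int l"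
        by (auto simp: Q_def)
      then have "\<phi> $ j - \<phi> $ i = \<theta> $ j - \<theta> $ i + 2 * pi * of_int (- l)" by simp
      then show ?thesis unfolding Q_def by blast
    qed
    show "Q i l" if "Q i j" "Q j l" for i j l
    proof -
      from that obtain m n :: int where "\<phi> $ i - \<phi> $ j = \<theta> $ i - \<theta> $ j + 2 * pi * of_int m"
        "\<phi> $ j - \<phi> $ l = \<theta> $ j - \<theta> $ l + 2 * pi * of_int n"
        by (auto simp: Q_def)
      then have "\<phi> $ i - \<phi> $ l = \<theta> $ i - \<theta> $ l + 2 * pi * of_int (m + n)"
        by (simp add: algebra_simps)
      then show ?thesis unfolding Q_def by blast
    qed
  qed
  then have "\<forall>i. \<exists>l::int. \<phi> $ i - \<phi> $ undefined = \<theta> $ i - \<theta> $ undefined + 2 * pi * of_int l"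
    by (simp add: Q_def)
  then obtain m :: "'a \<Rightarrow> int" where
    "\<And>i. \<phi> $ i - \<phi> $ undefined = \<theta> $ i - \<theta> $ undefined + 2 * pi * of_int (m i)" by metis
  then have "\<forall>i. \<phi> $ i = \<theta> $ i + (\<phi> $ undefined - \<theta> $ undefined) + 2 * pi * of_int (m i)"
    by (simp add: algebra_simps)
  then show ?thesis unfolding orbit_def by blast
qed

subsection \<open>Power flow\<close>

definition edge_weights ::
  "('n \<times> 'n) set \<Rightarrow> complex ^ 'n ^ 'n \<Rightarrow> ('n \<Rightarrow> real) \<Rightarrow> real ^ ('n::finite \<times> 'n)" where
  "edge_weights E Y V = (\<chi> e. if e \<in> E then Im (Y $ fst e $ snd e) * V (fst e) * V (snd e) else 0)"

lemma weight_matrix_mult: "(weight_matrix E Y V *v x) $ e = edge_weights E Y V $ e * x $ e"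
proof -
  have "weight_matrix E Y V $ e $ f * x $ f = (if f = e then edge_weights E Y V $ e * x $ e else 0)" for f
    by (cases "f = e") (simp_all add: weight_matrix_def edge_weights_def)
  then have "(weight_matrix E Y V *v x) $ e = (\<Sum>f\<in>UNIV. if f = e then edge_weights E Y V $ e * x $ e else 0)"
    by (simp add: matrix_vector_mult_def)
  then show ?thesis by simp
qed

lemma edge_inv_weight_matrix:
  assumes pos: "\<And>e. e \<in> E \<Longrightarrow> edge_weights E Y V $ e > 0" and "x \<in> edge_space E"
  shows "edge_inv E (weight_matrix E Y V) (\<chi> e. edge_weights E Y V $ e * x $ e) = x"
proof -
  have "inj_on (\<lambda>x. weight_matrix E Y V *v x) (edge_space E)"
  proof (rule inj_onI)
    fix x y assume xy: "x \<in> edge_space E" "y \<in> edge_space E"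
      "weight_matrix E Y V *v x = weight_matrix E Y V *v y"
    have "x $ e = y $ e" for e
    proof (cases "e \<in> E")
      case True
      then show ?thesis
        using arg_cong[OF xy(3), of "\<lambda>z. z $ e"] pos[OF True] by (simp add: weight_matrix_mult)
    next
      case False
      then show ?thesis using edge_space_nth[OF xy(1)] edge_space_nth[OF xy(2)] by simp
    qed
    then show "x = y" unfolding vec_eq_iff by blast
  qed
  moreover have "weight_matrix E Y V *v x = (\<chi> e. edge_weights E Y V $ e * x $ e)"
    unfolding vec_eq_iff weight_matrix_mult by simp
  ultimately show ?thesis
    using inv_into_f_f[OF _ assms(2), of "\<lambda>x. weight_matrix E Y V *v x"] by (simp add: edge_inv_def)
qed

text \<open>The power flow sums over ordered pairs, while \<open>E\<close> holds each line in one
  orientation. Symmetry of the susceptances and oddness of sine account for the reversed one;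
  diagonal terms vanish with \<open>sin 0\<close>.\<close>

lemma P_e_incidence:
  assumes "asym E" and sym: "\<And>i j. (i, j) \<in> E \<Longrightarrow> Im (Y $ j $ i) = Im (Y $ i $ j)"
    and no_line: "\<And>i j. i \<noteq> j \<Longrightarrow> \<not> adjacent E i j \<Longrightarrow> Y $ i $ j = 0"
  shows "P_e Y V \<theta> = incidence E *v
    (\<chi> e. edge_weights E Y V $ e * sin ((transpose (incidence E) *v \<theta>) $ e))"
proof -
  have "Im (Y $ i $ j) * V i * V j * sin (\<theta> $ i - \<theta> $ j) =
    (if (i, j) \<in> E then edge_weights E Y V $ (i, j) * sin (\<theta> $ i - \<theta> $ j) else 0)
    - (if (j, i) \<in> E then edge_weights E Y V $ (j, i) * sin (\<theta> $ j - \<theta> $ i) else 0)" for i j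
  proof (cases "i = j")
    case True
    then show ?thesis using asym_no_loop[OF assms(1)] by simp
  next
    case False
    have sin: "sin (\<theta> $ i - \<theta> $ j) = - sin (\<theta> $ j - \<theta> $ i)"
      by (metis minus_diff_eq sin_minus)
    consider "(i, j) \<in> E" "(j, i) \<notin> E" | "(j, i) \<in> E" "(i, j) \<notin> E" | "\<not> adjacent E i j"
      using assms(1) by (auto simp: adjacent_def dest: asymD)
    then show ?thesis
    proof cases
      case 1
      then show ?thesis by (simp add: edge_weights_def)
    next
      case 2
      then show ?thesis using sym[OF 2(1)] by (simp add: edge_weights_def sin)
    next
      case 3
      then show ?thesis using no_line[OF False] by (simp add: adjacent_def)
    qed
  qed
  note summand = this
  have *: "(if (i, j) \<in> E then edge_weights E Y V $ (i, j) * sin ((transpose (incidence E) *v \<theta>) $ (i, j)) else 0)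
    = (if (i, j) \<in> E then edge_weights E Y V $ (i, j) * sin (\<theta> $ i - \<theta> $ j) else 0)" for i j
    unfolding transpose_incidence_nth[OF assms(1)] by simp
  show ?thesis
    unfolding vec_eq_iff P_e_def incidence_mult_nth[OF assms(1)] vec_lambda_beta * summand by simp
qed

section \<open>The closed loop\<close>

text \<open>The bound passes to the infimum without choosing a nearest point: otherwise some point
  of \<open>M\<close> would be closer than both \<open>y / c\<close> and
  \<open>\<delta>\<close>.\<close>

lemma infdist_le_of_points:
  assumes "M \<noteq> {}" "infdist x M < \<delta>" "c > 0"
    and bound: "\<And>a. a \<in> M \<Longrightarrow> dist x a < \<delta> \<Longrightarrow> y \<le> c * dist x a"
  shows "y \<le> c * infdist x M"
proof (rule ccontr)
  assume "\<not> y \<le> c * infdist x M"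
  then have "infdist x M < min (y / c) \<delta>"
    using assms by (simp add: field_simps)
  then obtain a where "a \<in> M" "dist x a < min (y / c) \<delta>"
    unfolding infdist_notempty[OF \<open>M \<noteq> {}\<close>]
    by (subst (asm) cINF_less_iff) (auto simp: \<open>M \<noteq> {}\<close> intro!: bdd_belowI[of _ 0])
  then show False
    using bound[of a] \<open>c > 0\<close> by (simp add: field_simps)
qed

lemma const_of_zero_derivative_halfline:
  fixes f :: "real \<Rightarrow> real"
  assumes "\<And>t. t \<ge> 0 \<Longrightarrow> (f has_real_derivative 0) (at t within {0..})" "t \<ge> 0"
  shows "f t = f 0"
proof -
  obtain c where "\<forall>t\<in>{0..}. f t = c"
    using has_field_derivative_zero_constant[of "{0..}" f] assms(1) by auto
  then show ?thesis using assms(2) by simp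
qed

lemma infnorm_less_iff: "infnorm x < b \<longleftrightarrow> (\<forall>i. \<bar>x $ i\<bar> < b)" for x :: "real ^ 'i::finite"
proof -
  have "{\<bar>x $ i\<bar> |i. i \<in> UNIV} = range (\<lambda>i. \<bar>x $ i\<bar>)" by auto
  then have "infnorm x = Max (range (\<lambda>i. \<bar>x $ i\<bar>))"
    unfolding infnorm_cart by (simp add: cSup_eq_Max)
  then show ?thesis by (simp add: Max_less_iff)
qed

text \<open>The equilibrium state of the integrators, extended by 0 to the loads.\<close>

definition sync_input :: "'n set \<Rightarrow> ('n \<Rightarrow> real) \<Rightarrow> real ^ 'n \<Rightarrow> real ^ ('n::finite)" where
  "sync_input V\<^sub>I D P = (\<chi> i. if i \<in> V\<^sub>I then D i * \<omega>_sync V\<^sub>I D P else 0)"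

section \<open>The microgrid as a network with shifted injections\<close>

locale microgrid =
  fixes E :: "('n::finite \<times> 'n) set" and V\<^sub>L V\<^sub>I :: "'n set"
    and Y :: "complex ^ 'n ^ 'n" and V D :: "'n \<Rightarrow> real" and P :: "real ^ 'n" and k :: real
  assumes asym: "asym E" and connected: "connected_graph E" and acyclic: "acyclic_graph E"
    and partition: "V\<^sub>L = - V\<^sub>I" and V\<^sub>I_nonempty: "V\<^sub>I \<noteq> {}"
    and Y_sym: "(i, j) \<in> E \<Longrightarrow> Im (Y $ j $ i) = Im (Y $ i $ j)"
    and Y_pos: "(i, j) \<in> E \<Longrightarrow> Im (Y $ i $ j) > 0"
    and no_line: "i \<noteq> j \<Longrightarrow> \<not> adjacent E i j \<Longrightarrow> Y $ i $ j = 0"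
    and V_pos: "V i > 0"
    and D_pos: "i \<in> V\<^sub>I \<Longrightarrow> D i > 0"
    and k_pos: "k > 0"
begin

abbreviation "\<omega> \<equiv> \<omega>_sync V\<^sub>I D P"
abbreviation "P' \<equiv> P_shift V\<^sub>I D P"
abbreviation "weights \<equiv> edge_weights E Y V"
abbreviation "p_sync \<equiv> sync_input V\<^sub>I D P"

lemma sum_D_pos: "(\<Sum>i\<in>V\<^sub>I. D i) > 0"
  by (intro sum_pos) (auto simp: V\<^sub>I_nonempty D_pos)

lemma D_nonzero: "i \<in> V\<^sub>I \<Longrightarrow> D i \<noteq> 0"
  using D_pos by force

lemma sum_P_eq: "(\<Sum>i\<in>UNIV. P $ i) = (\<Sum>i\<in>V\<^sub>I. D i) * \<omega>"
  using sum_D_pos by (simp add: \<omega>_sync_def)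

lemma sum_shift_eq_0: "(\<Sum>i\<in>UNIV. P' $ i) = 0"
proof -
  have "(\<Sum>i\<in>UNIV. P' $ i) = (\<Sum>i\<in>UNIV. P $ i - (if i \<in> V\<^sub>I then D i * \<omega> else 0))"
    by (intro sum.cong) (auto simp: P_shift_def)
  also have "\<dots> = (\<Sum>i\<in>UNIV. P $ i) - (\<Sum>i\<in>V\<^sub>I. D i * \<omega>)"
    by (simp add: sum_subtractf flip: sum.inter_filter)
  finally show ?thesis using sum_P_eq by (simp add: sum_distrib_right)
qed

lemma weights_pos: "e \<in> E \<Longrightarrow> weights $ e > 0"
  using Y_pos[of "fst e" "snd e"] V_pos by (simp add: edge_weights_def)

lemma weights_outside: "e \<notin> E \<Longrightarrow> weights $ e = 0"
  by (simp add: edge_weights_def)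

text \<open>The network is fed with \<open>P'\<close> instead of \<open>P\<close>: the shifted
  injections are balanced, and residuals then vanish exactly at the synchronous equilibria.\<close>

sublocale flow: flow_network "incidence E" weights V\<^sub>I D P'
proof
  show "weights $ e \<ge> 0" for e
    using weights_pos[of e] weights_outside[of e] by (cases "e \<in> E") auto
  show "(transpose (incidence E) *v \<theta>) $ e = 0" if "weights $ e = 0" for e \<theta>
  proof -
    have "e \<notin> E" using that weights_pos[of e] by auto
    then show ?thesis by (rule edge_space_nth[OF transpose_incidence_in_edge_space])
  qed
  show "transpose (incidence E) *v \<theta> = 0 \<longleftrightarrow> (\<exists>c. \<theta> = vec c)" for \<theta>
    by (rule transpose_incidence_kernel[OF asym connected])
qed (use D_pos V\<^sub>I_nonempty sum_shift_eq_0 in auto)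

lemma tension_nth: "flow.tension \<theta> $ (i, j) = (if (i, j) \<in> E then \<theta> $ i - \<theta> $ j else 0)"
  unfolding flow.tension_def by (rule transpose_incidence_nth[OF asym])

lemma injection_eq_P_e: "flow.injection \<theta> = P_e Y V \<theta>"
  unfolding flow.injection_def flow.tension_def
  by (rule P_e_incidence[OF asym Y_sym no_line, symmetric])

lemma residual_eq: "flow.residual \<theta> = P' - P_e Y V \<theta>"
  by (simp add: flow.residual_def injection_eq_P_e)

lemma residual_nth:
  "flow.residual \<theta> $ i = (if i \<in> V\<^sub>I then P $ i - D i * \<omega> else P $ i) - P_e Y V \<theta> $ i"
  unfolding residual_eq by (simp add: P_shift_def)

lemma sum_P_e: "(\<Sum>i\<in>UNIV. P_e Y V \<theta> $ i) = 0"
  using flow.residual_sum[of \<theta>] sum_shift_eq_0 by (simp add: residual_eq sum_subtractf)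

lemma CAPI_space_outside: "p \<in> CAPI_space V\<^sub>I D \<Longrightarrow> i \<notin> V\<^sub>I \<Longrightarrow> p $ i = 0"
  unfolding CAPI_space_def inverter_space_def by blast

lemma CAPI_space_eq:
  assumes "p \<in> CAPI_space V\<^sub>I D" "i \<in> V\<^sub>I" "j \<in> V\<^sub>I"
  shows "p $ i = D i * (p $ j / D j)"
proof -
  have eq: "p $ i / D i = p $ j / D j" using assms unfolding CAPI_space_def by blast
  have "p $ i = D i * (p $ i / D i)" using D_pos[OF assms(2)] by simp
  then show ?thesis unfolding eq .
qed

lemma p_sync_in_CAPI_space: "p_sync \<in> CAPI_space V\<^sub>I D"
proof -
  have "p_sync $ i / D i = \<omega>" if "i \<in> V\<^sub>I" for i
    using D_nonzero[OF that] that by (simp add: sync_input_def)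
  then show ?thesis
    by (simp add: CAPI_space_def inverter_space_def) (simp add: sync_input_def)
qed

section \<open>Equilibria of the closed loop\<close>

lemma sum_partition: "(\<Sum>i\<in>UNIV. f i) = (\<Sum>i\<in>V\<^sub>L. f i) + (\<Sum>i\<in>V\<^sub>I. f i)" for f :: "'n \<Rightarrow> real"
  unfolding partition Compl_eq_Diff_UNIV by (rule sum.subset_diff) auto

text \<open>At rest the integrator equations are trivial, so the common value of
  \<open>p $ i / D i\<close> is fixed by summing all node balances: the network flows cancel, which
  forces it to be \<open>\<omega>\<close>.\<close>

lemma equilibrium_iff:
  "closed_loop_equilibrium V\<^sub>L V\<^sub>I Y V D k P \<theta> p \<longleftrightarrow> P_e Y V \<theta> = P' \<and> p = p_sync"
proof
  assume "closed_loop_equilibrium V\<^sub>L V\<^sub>I Y V D k P \<theta> p"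
  then have p: "p \<in> CAPI_space V\<^sub>I D" and L: "\<And>i. i \<in> V\<^sub>L \<Longrightarrow> P_e Y V \<theta> $ i = P $ i"
    and I: "\<And>i. i \<in> V\<^sub>I \<Longrightarrow> P_e Y V \<theta> $ i = P $ i - p $ i"
    by (auto simp: closed_loop_equilibrium_def closed_loop_eqs_def droop_eqs_def)
  obtain j where j: "j \<in> V\<^sub>I" using V\<^sub>I_nonempty by blast
  define q where "q = p $ j / D j"
  have q: "p $ i = D i * q" if "i \<in> V\<^sub>I" for i
    unfolding q_def by (rule CAPI_space_eq[OF p that j])
  have "0 = (\<Sum>i\<in>UNIV. P_e Y V \<theta> $ i)" by (simp add: sum_P_e)
  also have "\<dots> = (\<Sum>i\<in>UNIV. P $ i) - (\<Sum>i\<in>V\<^sub>I. D i) * q"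
    unfolding sum_partition by (simp add: L I q sum_subtractf sum_distrib_right)
  finally have "q = \<omega>" using sum_P_eq sum_D_pos by simp
  then have "p = p_sync"
    using q CAPI_space_outside[OF p] by (simp add: vec_eq_iff sync_input_def)
  moreover have "P_e Y V \<theta> = P'"
    using L I q \<open>q = \<omega>\<close> partition by (auto simp: vec_eq_iff P_shift_def)
  ultimately show "P_e Y V \<theta> = P' \<and> p = p_sync" by simp
next
  assume "P_e Y V \<theta> = P' \<and> p = p_sync"
  then show "closed_loop_equilibrium V\<^sub>L V\<^sub>I Y V D k P \<theta> p"
    using p_sync_in_CAPI_space partition
    by (auto simp: closed_loop_equilibrium_def closed_loop_eqs_def droop_eqs_def CAPI_eqs_def
        P_shift_def sync_input_def)
qed

lemma droop_equilibrium_iff: "droop_equilibrium V\<^sub>L V\<^sub>I Y V D P' \<phi> \<longleftrightarrow> P_e Y V \<phi> = P'"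
  unfolding droop_equilibrium_def droop_eqs_def vec_eq_iff partition
  by (metis (no_types, lifting) ComplI add.right_neutral diff_eq_eq diff_self mult_zero_right zero_index)

section \<open>Reduction to the shifted droop dynamics\<close>

lemma average_velocity:
  assumes "\<And>i. i \<in> V\<^sub>L \<Longrightarrow> P_e Y V \<theta> $ i = P $ i"
    and "\<And>i. i \<in> V\<^sub>I \<Longrightarrow> D i * w $ i = P $ i - P_e Y V \<theta> $ i - D i * q"
  shows "(\<Sum>i\<in>V\<^sub>I. D i * w $ i) / (\<Sum>i\<in>V\<^sub>I. D i) = \<omega> - q"
proof -
  have "(\<Sum>i\<in>V\<^sub>I. D i * w $ i) = (\<Sum>i\<in>V\<^sub>I. P $ i - P_e Y V \<theta> $ i - D i * q)"
    by (intro sum.cong refl assms(2))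
  also have "\<dots> = (\<Sum>i\<in>V\<^sub>I. P $ i - P_e Y V \<theta> $ i) - (\<Sum>i\<in>V\<^sub>I. D i) * q"
    by (simp add: sum_subtractf sum_distrib_right)
  also have "(\<Sum>i\<in>V\<^sub>I. P $ i - P_e Y V \<theta> $ i) = (\<Sum>i\<in>UNIV. P $ i - P_e Y V \<theta> $ i)"
    unfolding sum_partition using assms(1) by simp
  also have "\<dots> = (\<Sum>i\<in>V\<^sub>I. D i) * \<omega>"
    by (simp add: sum_subtractf sum_P_e sum_P_eq)
  finally show ?thesis using sum_D_pos by (simp add: field_simps)
qed

text \<open>
  In the CAPI space the controller state is a scalar \<open>q = p\<^sub>i / D\<^sub>i\<close> with
  \<open>k q' = \<omega> - q\<close>, and \<open>q - \<omega>\<close> only adds a common drift to the angles.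
\<close>

lemma closed_loop_solution_decouples:
  assumes x: "x \<in> closed_loop_solutions V\<^sub>L V\<^sub>I Y V D k P"
    and x0: "x 0 \<in> closed_loop_initial_states V\<^sub>L V\<^sub>I Y V D P"
    and \<theta>1: "P_e Y V \<theta>1 = P'"
    and cos: "\<And>e y. weights $ e \<noteq> 0 \<Longrightarrow> \<bar>y - flow.tension \<theta>1 $ e\<bar> \<le> \<epsilon> \<Longrightarrow> c \<le> cos y"
  obtains \<theta>' s where "flow.droop_motion c \<epsilon> \<theta>1 (\<lambda>t. fst (x t)) \<theta>' s"
    "\<And>t. t \<ge> 0 \<Longrightarrow> snd (x t) - p_sync = exp (- t / k) *\<^sub>R (snd (x 0) - p_sync)"
proof -
  from x obtain \<theta>' dp where
    inv: "\<And>t. t \<ge> 0 \<Longrightarrow> snd (x t) \<in> inverter_space V\<^sub>I"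
    and der: "\<And>t. t \<ge> 0 \<Longrightarrow> (x has_vector_derivative (\<theta>' t, dp t)) (at t within {0..})"
    and eqs: "\<And>t. t \<ge> 0 \<Longrightarrow> closed_loop_eqs V\<^sub>L V\<^sub>I Y V D k P (fst (x t)) (snd (x t)) (\<theta>' t) (dp t)"
    unfolding closed_loop_solutions_def by blast
  have L: "P_e Y V (fst (x t)) $ i = P $ i" if "t \<ge> 0" "i \<in> V\<^sub>L" for t i
    using eqs[OF that(1)] that(2) by (auto simp: closed_loop_eqs_def droop_eqs_def)
  have I: "D i * \<theta>' t $ i = P $ i - P_e Y V (fst (x t)) $ i - snd (x t) $ i" if "t \<ge> 0" "i \<in> V\<^sub>I" for t i
    using eqs[OF that(1)] that(2) by (auto simp: closed_loop_eqs_def droop_eqs_def)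
  have dp: "dp t $ i / D i = (\<Sum>j\<in>V\<^sub>I. D j * \<theta>' t $ j) / (\<Sum>j\<in>V\<^sub>I. D j) / k" if "t \<ge> 0" "i \<in> V\<^sub>I" for t i
  proof -
    have "k / D i * dp t $ i = (\<Sum>j\<in>V\<^sub>I. D j * \<theta>' t $ j) / (\<Sum>j\<in>V\<^sub>I. D j)"
      using eqs[OF that(1)] that(2) by (simp add: closed_loop_eqs_def CAPI_eqs_def)
    then show ?thesis using k_pos by (simp flip: \<open>k / D i * dp t $ i = _\<close>)
  qed
  have der_\<theta>: "((\<lambda>t. fst (x t)) has_vector_derivative \<theta>' t) (at t within {0..})" if "t \<ge> 0" for t
    using bounded_linear.has_vector_derivative[OF bounded_linear_fst der[OF that]] by simp
  have der_p: "((\<lambda>t. snd (x t) $ i / D i) has_real_derivative dp t $ i / D i) (at t within {0..})"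
    if "t \<ge> 0" for t i
  proof -
    have "((\<lambda>t. snd (x t) $ i) has_real_derivative dp t $ i) (at t within {0..})"
      using bounded_linear.has_vector_derivative[OF
          bounded_linear_compose[OF bounded_linear_vec_nth bounded_linear_snd] der[OF that]]
      by (simp add: has_real_derivative_iff_has_vector_derivative)
    then show ?thesis by (rule DERIV_cdivide)
  qed
  obtain j where j: "j \<in> V\<^sub>I" using V\<^sub>I_nonempty by blast
  define q where "q t = snd (x t) $ j / D j" for t
  have p0: "snd (x 0) \<in> CAPI_space V\<^sub>I D"
    using x0 by (auto simp: closed_loop_initial_states_def)
  have q: "snd (x t) $ i = D i * q t" if "t \<ge> 0" "i \<in> V\<^sub>I" for t i
  proof -
    have "snd (x t) $ i / D i - q t = snd (x 0) $ i / D i - q 0"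
      unfolding q_def
    proof (rule const_of_zero_derivative_halfline[OF _ \<open>t \<ge> 0\<close>])
      fix t :: real assume "t \<ge> 0"
      show "((\<lambda>t. snd (x t) $ i / D i - snd (x t) $ j / D j) has_real_derivative 0) (at t within {0..})"
        using DERIV_diff[OF der_p der_p, OF \<open>t \<ge> 0\<close> \<open>t \<ge> 0\<close>, of i j]
        by (simp add: dp \<open>t \<ge> 0\<close> \<open>i \<in> V\<^sub>I\<close> j)
    qed
    also have "\<dots> = 0"
      using CAPI_space_eq[OF p0 that(2) j] D_pos[OF that(2)] by (simp add: q_def)
    finally show ?thesis using D_pos[OF that(2)] by (simp add: field_simps)
  qed
  have dq: "(q has_real_derivative (\<omega> - q t) / k) (at t within {0..})" if "t \<ge> 0" for t
  proof -
    have "(\<Sum>i\<in>V\<^sub>I. D i * \<theta>' t $ i) / (\<Sum>i\<in>V\<^sub>I. D i) = \<omega> - q t"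
      using L I q that by (intro average_velocity[of "fst (x t)"]) auto
    with dp[OF that j] der_p[OF that, of j] show ?thesis by (simp add: q_def[abs_def])
  qed
  have s: "q t - \<omega> = (q 0 - \<omega>) * exp (- t / k)" if "t \<ge> 0" for t
  proof -
    have "(q t - \<omega>) * exp (t / k) = (q 0 - \<omega>) * exp (0 / k)"
    proof (rule const_of_zero_derivative_halfline[OF _ that])
      fix t :: real assume "t \<ge> 0"
      show "((\<lambda>t. (q t - \<omega>) * exp (t / k)) has_real_derivative 0) (at t within {0..})"
        using k_pos
        by (auto intro!: derivative_eq_intros dq[OF \<open>t \<ge> 0\<close>] simp: field_simps)
    qed
    then show ?thesis by (simp add: exp_minus field_simps)
  qed
  have "snd (x t) - p_sync = exp (- t / k) *\<^sub>R (snd (x 0) - p_sync)" if "t \<ge> 0" for t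
  proof (subst vec_eq_iff, rule allI)
    fix i
    show "(snd (x t) - p_sync) $ i = (exp (- t / k) *\<^sub>R (snd (x 0) - p_sync)) $ i"
    proof (cases "i \<in> V\<^sub>I")
      case True
      have "D i * q t - D i * \<omega> = D i * (q t - \<omega>)" by (simp add: algebra_simps)
      also have "\<dots> = exp (- t / k) * (D i * q 0 - D i * \<omega>)"
        unfolding s[OF that] by (simp add: algebra_simps)
      finally show ?thesis using True that by (simp add: q sync_input_def)
    next
      case False
      then show ?thesis
        using inv[OF that] inv[of 0] by (simp add: inverter_space_def sync_input_def)
    qed
  qed
  moreover have "flow.droop_motion c \<epsilon> \<theta>1 (\<lambda>t. fst (x t)) \<theta>' (\<lambda>t. q t - \<omega>)"
  proof -
    have load: "flow.residual (fst (x t)) $ i = 0" if "t \<ge> 0" "i \<notin> V\<^sub>I" for t i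
      using L[of t i] that partition by (simp add: residual_nth)
    \<comment> \<open>For a true solution the load residuals vanish identically, so at positive
      times their two-sided derivative is 0.\<close>
    have "flow.flow_rate (fst (x t)) (\<theta>' t) $ i = 0" if "t > 0" "i \<notin> V\<^sub>I" for t i
    proof -
      have "at t within {0..} = at t" using that by (intro at_within_interior) auto
      then have "((\<lambda>t. flow.residual (fst (x t)) $ i) has_real_derivative
          - flow.flow_rate (fst (x t)) (\<theta>' t) $ i) (at t)"
        using flow.residual_has_derivative[OF der_\<theta>, of t i] that by simp
      moreover have "((\<lambda>t. flow.residual (fst (x t)) $ i) has_real_derivative 0) (at t)"
        by (rule has_field_derivative_transform_within_open[where f = "\<lambda>_. 0" and S = "{0<..}"])
           (use that load in auto)
      ultimately show ?thesis using DERIV_unique by fastforce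
    qed
    moreover have "D i * (\<theta>' t $ i + (q t - \<omega>)) = flow.residual (fst (x t)) $ i" if "t \<ge> 0" "i \<in> V\<^sub>I" for t i
      using I[OF that] that by (simp add: q residual_nth algebra_simps)
    ultimately show ?thesis
      unfolding flow.droop_motion_def injection_eq_P_e
      using \<theta>1 cos der_\<theta> load by blast
  qed
  ultimately show ?thesis using that by blast
qed

text \<open>The converse reconstruction: \<open>q = \<omega> + s\<close> with
  \<open>s = s0 * exp (- t / k)\<close> solves \<open>k q' = \<omega> - q\<close>, and the load
  equations make the average velocity equal to \<open>- s\<close>.\<close>

lemma closed_loop_solution_of_droop_motion:
  assumes m: "flow.droop_motion c \<epsilon> \<theta>1 \<theta> \<theta>' (\<lambda>t. s0 * exp (- t / k))"
    and load: "\<And>t i. t \<ge> 0 \<Longrightarrow> i \<notin> V\<^sub>I \<Longrightarrow> flow.residual (\<theta> t) $ i = 0"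
  shows "(\<lambda>t. (\<theta> t, \<chi> i. if i \<in> V\<^sub>I then D i * (\<omega> + s0 * exp (- t / k)) else 0))
    \<in> closed_loop_solutions V\<^sub>L V\<^sub>I Y V D k P"
proof -
  define p where "p t = (\<chi> i. if i \<in> V\<^sub>I then D i * (\<omega> + s0 * exp (- t / k)) else 0)" for t
  define dp where "dp t = (\<chi> i. if i \<in> V\<^sub>I then D i * (- s0 * exp (- t / k) / k) else 0)" for t
  have der: "(\<theta> has_vector_derivative \<theta>' t) (at t within {0..})" if "t \<ge> 0" for t
    using m that by (simp add: flow.droop_motion_def)
  have "(p has_vector_derivative dp t) (at t within {0..})" for t
  proof -
    have "p = (\<lambda>t. p_sync + exp (- t / k) *\<^sub>R (\<chi> i. if i \<in> V\<^sub>I then D i * s0 else 0))"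
      by (auto simp: p_def sync_input_def vec_eq_iff algebra_simps)
    moreover have "dp t = (- exp (- t / k) / k) *\<^sub>R (\<chi> i. if i \<in> V\<^sub>I then D i * s0 else 0)"
      by (auto simp: dp_def vec_eq_iff)
    moreover have "((\<lambda>t. exp (- t / k)) has_real_derivative - exp (- t / k) / k) (at t within {0..})"
      using k_pos by (auto intro!: derivative_eq_intros)
    ultimately show ?thesis
      using k_pos by (auto intro!: derivative_eq_intros)
  qed
  then have "((\<lambda>t. (\<theta> t, p t)) has_vector_derivative (\<theta>' t, dp t)) (at t within {0..})" if "t \<ge> 0" for t
    using der[OF that] by (rule has_vector_derivative_Pair[rotated])
  moreover have "p t \<in> inverter_space V\<^sub>I" for t
    by (simp add: p_def inverter_space_def)
  moreover have "closed_loop_eqs V\<^sub>L V\<^sub>I Y V D k P (\<theta> t) (p t) (\<theta>' t) (dp t)" if "t \<ge> 0" for t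
  proof -
    have L: "P_e Y V (\<theta> t) $ i = P $ i" if "i \<in> V\<^sub>L" for i
      using load[OF \<open>t \<ge> 0\<close>, of i] that partition by (simp add: residual_nth)
    have I: "D i * \<theta>' t $ i = P $ i - P_e Y V (\<theta> t) $ i - D i * (\<omega> + s0 * exp (- t / k))"
      if "i \<in> V\<^sub>I" for i
    proof -
      have "D i * (\<theta>' t $ i + s0 * exp (- t / k)) = flow.residual (\<theta> t) $ i"
        using m \<open>t \<ge> 0\<close> that by (simp add: flow.droop_motion_def)
      then show ?thesis using that by (simp add: residual_nth algebra_simps)
    qed
    have "(\<Sum>i\<in>V\<^sub>I. D i * \<theta>' t $ i) / (\<Sum>i\<in>V\<^sub>I. D i) = \<omega> - (\<omega> + s0 * exp (- t / k))"
      by (rule average_velocity[OF L I])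
    then show ?thesis
      using L I k_pos
      by (auto simp: closed_loop_eqs_def droop_eqs_def CAPI_eqs_def p_def dp_def D_nonzero)
  qed
  ultimately have "(\<lambda>t. (\<theta> t, p t)) \<in> closed_loop_solutions V\<^sub>L V\<^sub>I Y V D k P"
    unfolding closed_loop_solutions_def by (intro CollectI exI[of _ \<theta>'] exI[of _ dp]) auto
  then show ?thesis by (simp add: p_def)
qed

section \<open>Local exponential stability of the equilibrium manifold\<close>

lemma locally_exponentially_stable_orbit:
  assumes eq: "P_e Y V \<theta>0 = P'" and \<gamma>: "\<gamma> \<ge> 0" "\<gamma> < pi / 2"
    and arc: "\<And>i j. (i, j) \<in> E \<Longrightarrow> \<bar>\<theta>0 $ i - \<theta>0 $ j\<bar> \<le> \<gamma>"
  shows "locally_exponentially_stable (closed_loop_initial_states V\<^sub>L V\<^sub>I Y V D P)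
    (closed_loop_solutions V\<^sub>L V\<^sub>I Y V D k P) (orbit \<theta>0 \<times> {p_sync})"
proof -
  \<comment> \<open>Half of the gap between \<open>\<gamma>\<close> and a quarter turn: deviations
    up to \<open>\<epsilon>\<close> keep every cosine at least \<open>c > 0\<close>.\<close>
  define \<epsilon> where "\<epsilon> = (pi / 2 - \<gamma>) / 2"
  define c where "c = cos (\<gamma> + \<epsilon>)"
  have "\<epsilon> > 0" using \<gamma> by (simp add: \<epsilon>_def)
  have \<gamma>\<epsilon>: "0 < \<gamma> + \<epsilon>" "\<gamma> + \<epsilon> < pi / 2" using \<gamma> by (auto simp: \<epsilon>_def field_simps)
  then have c: "0 < c" "c \<le> 1" unfolding c_def by (auto intro!: cos_gt_zero_pi)
  have cos: "c \<le> cos y"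
    if \<theta>1: "\<theta>1 \<in> orbit \<theta>0" and "weights $ e \<noteq> 0" "\<bar>y - flow.tension \<theta>1 $ e\<bar> \<le> \<epsilon>" for \<theta>1 e y
  proof -
    obtain i j where e: "e = (i, j)" by (cases e)
    then have "(i, j) \<in> E" using that(2) weights_outside by blast
    \<comment> \<open>Another lift of the orbit may change an edge difference by full turns, which
      the cosine does not notice; hence the same \<open>c\<close> works at every point of the
      orbit.\<close>
    obtain l :: int where "\<theta>1 $ i - \<theta>1 $ j = \<theta>0 $ i - \<theta>0 $ j + 2 * pi * of_int l"
      by (rule orbit_differences[OF \<theta>1])
    with that(3) e \<open>(i, j) \<in> E\<close> have "\<bar>y + 2 * pi * of_int (- l) - (\<theta>0 $ i - \<theta>0 $ j)\<bar> \<le> \<epsilon>"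
      by (simp add: tension_nth algebra_simps)
    with arc[OF \<open>(i, j) \<in> E\<close>] have "\<bar>y + 2 * pi * of_int (- l)\<bar> \<le> \<gamma> + \<epsilon>" by linarith
    then have "cos (\<gamma> + \<epsilon>) \<le> cos \<bar>y + 2 * pi * of_int (- l)\<bar>"
      using \<gamma>\<epsilon> by (intro cos_monotone_0_pi_le) auto
    then show ?thesis
      unfolding cos_abs_real cos_add_int_2pi by (simp add: c_def)
  qed
  have eq1: "P_e Y V \<theta>1 = P'" if "\<theta>1 \<in> orbit \<theta>0" for \<theta>1
    using P_e_orbit[OF that] eq by simp
  obtain \<delta> K r where \<delta>: "\<delta> > 0" "K > 0" "r > 0" and stable:
    "\<And>\<theta>1 \<theta> \<theta>' s t. flow.droop_motion c \<epsilon> \<theta>1 \<theta> \<theta>' s \<Longrightarrow> norm (\<theta> 0 - \<theta>1) < \<delta> \<Longrightarrow> t \<ge> 0 \<Longrightarrow>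
       norm (flow.tension (\<theta> t - \<theta>1)) < \<epsilon> \<and> (\<forall>i. i \<notin> V\<^sub>I \<longrightarrow> flow.residual (\<theta> t) $ i = 0) \<and>
       (\<exists>\<gamma>. norm (\<theta> t - \<theta>1 - vec \<gamma>) \<le> K * exp (- r * t) * norm (\<theta> 0 - \<theta>1))"
    using flow.droop_motion_stable[OF c(1) \<open>\<epsilon> > 0\<close>] by blast
  define M where "M = orbit \<theta>0 \<times> {p_sync}"
  have M: "M \<noteq> {}" using orbit_self by (auto simp: M_def)
  \<comment> \<open>Angles decay at rate \<open>r\<close> and integrators at rate
    \<open>1 / k\<close>; the slower rate governs the product.\<close>
  define r' where "r' = min r (1 / k)"
  have "r' > 0" using \<delta> k_pos by (simp add: r'_def)
  have exists: "\<exists>x\<in>closed_loop_solutions V\<^sub>L V\<^sub>I Y V D k P. x 0 = x0"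
    if x0: "x0 \<in> closed_loop_initial_states V\<^sub>L V\<^sub>I Y V D P" and near: "infdist x0 M < \<delta>" for x0
  proof -
    obtain \<theta>i p0 where x0_eq: "x0 = (\<theta>i, p0)" by (cases x0)
    have p: "p0 \<in> CAPI_space V\<^sub>I D" and load: "\<And>i. i \<in> V\<^sub>L \<Longrightarrow> P_e Y V \<theta>i $ i = P $ i"
      using x0 by (auto simp: x0_eq closed_loop_initial_states_def)
    from near obtain a where "a \<in> M" "dist x0 a < \<delta>"
      unfolding infdist_notempty[OF M]
      by (subst (asm) cINF_less_iff) (auto simp: M intro!: bdd_belowI[of _ 0])
    then obtain \<theta>1 where \<theta>1: "\<theta>1 \<in> orbit \<theta>0" "norm (\<theta>i - \<theta>1) < \<delta>"
      using dist_fst_le[of x0 a] by (auto simp: M_def x0_eq dist_norm)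
    obtain j where j: "j \<in> V\<^sub>I" using V\<^sub>I_nonempty by blast
    define s0 where "s0 = p0 $ j / D j - \<omega>"
    obtain \<theta> \<theta>' where \<theta>: "\<theta> 0 = \<theta>i" "flow.droop_motion c \<epsilon> \<theta>1 \<theta> \<theta>' (\<lambda>t. s0 * exp (- t / k))"
    proof (rule flow.droop_motion_exists[OF c k_pos])
      show "flow.injection \<theta>1 = P'" unfolding injection_eq_P_e by (rule eq1[OF \<theta>1(1)])
      show "flow.residual \<theta>i $ i = 0" if "i \<notin> V\<^sub>I" for i
        using load[of i] that partition by (simp add: residual_nth)
    qed (use cos[OF \<theta>1(1)] in blast)+
    \<comment> \<open>By \<open>stable\<close> the load residuals of the regularized motion stay 0,
      so it solves the actual closed loop.\<close>
    have "(\<lambda>t. (\<theta> t, \<chi> i. if i \<in> V\<^sub>I then D i * (\<omega> + s0 * exp (- t / k)) else 0))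
        \<in> closed_loop_solutions V\<^sub>L V\<^sub>I Y V D k P"
      by (rule closed_loop_solution_of_droop_motion[OF \<theta>(2)]) (use stable[OF \<theta>(2)] \<theta> \<theta>1 in auto)
    moreover have "(\<chi> i. if i \<in> V\<^sub>I then D i * (\<omega> + s0 * exp (- 0 / k)) else 0) = p0"
      using CAPI_space_eq[OF p _ j] CAPI_space_outside[OF p] by (simp add: vec_eq_iff s0_def)
    ultimately show ?thesis using \<theta>(1) x0_eq by force
  qed
  have decay: "infdist (x t) M \<le> (K + 1) * exp (- r' * t) * infdist x0 M"
    if x0: "x0 \<in> closed_loop_initial_states V\<^sub>L V\<^sub>I Y V D P" and near: "infdist x0 M < \<delta>"
      and x: "x \<in> closed_loop_solutions V\<^sub>L V\<^sub>I Y V D k P" "x 0 = x0" and "t \<ge> 0" for x0 x t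
  proof (rule infdist_le_of_points[OF M near])
    show "0 < (K + 1) * exp (- r' * t)" using \<delta> by simp
    fix a assume "a \<in> M" and d: "dist x0 a < \<delta>"
    then obtain \<theta>1 where a: "a = (\<theta>1, p_sync)" and \<theta>1: "\<theta>1 \<in> orbit \<theta>0" by (auto simp: M_def)
    obtain \<theta>' s where m: "flow.droop_motion c \<epsilon> \<theta>1 (\<lambda>t. fst (x t)) \<theta>' s"
      and p: "\<And>t. t \<ge> 0 \<Longrightarrow> snd (x t) - p_sync = exp (- t / k) *\<^sub>R (snd (x 0) - p_sync)"
      using closed_loop_solution_decouples[OF x(1) x0[folded x(2)] eq1[OF \<theta>1], of \<epsilon> c] cos[OF \<theta>1]
      by blast
    have d1: "norm (fst (x 0) - \<theta>1) \<le> dist x0 a" "norm (snd (x 0) - p_sync) \<le> dist x0 a"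
      using dist_fst_le[of x0 a] dist_snd_le[of x0 a] x(2) by (auto simp: a dist_norm)
    obtain g where g: "norm (fst (x t) - \<theta>1 - vec g) \<le> K * exp (- r * t) * norm (fst (x 0) - \<theta>1)"
      using stable[OF m _ \<open>t \<ge> 0\<close>] d1(1) d by auto
    have "(\<theta>1 + vec g, p_sync) \<in> M" using orbit_add_vec[OF \<theta>1] by (simp add: M_def)
    then have "infdist (x t) M \<le> dist (x t) (\<theta>1 + vec g, p_sync)" by (rule infdist_le)
    also have "\<dots> = norm (fst (x t) - \<theta>1 - vec g, snd (x t) - p_sync)"
      by (cases "x t") (simp add: dist_norm algebra_simps)
    also have "\<dots> \<le> norm (fst (x t) - \<theta>1 - vec g) + norm (snd (x t) - p_sync)"
      by (rule norm_Pair_le)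
    also have "\<dots> \<le> K * exp (- r * t) * norm (fst (x 0) - \<theta>1) + exp (- t / k) * norm (snd (x 0) - p_sync)"
      using g by (simp add: p[OF \<open>t \<ge> 0\<close>])
    also have "\<dots> \<le> K * exp (- r' * t) * dist x0 a + exp (- r' * t) * dist x0 a"
    proof -
      have "exp (- r * t) \<le> exp (- r' * t)"
        using \<open>t \<ge> 0\<close> by (simp add: r'_def mult_right_mono)
      moreover have "exp (- t / k) \<le> exp (- r' * t)"
        using \<open>t \<ge> 0\<close> mult_right_mono[of r' "1 / k" t] by (simp add: r'_def)
      ultimately show ?thesis
        using \<delta> d1 by (intro add_mono mult_mono) auto
    qed
    finally show "infdist (x t) M \<le> (K + 1) * exp (- r' * t) * dist x0 a"
      by (simp add: algebra_simps)
  qed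
  show ?thesis
    unfolding locally_exponentially_stable_def M_def[symmetric]
    using exists decay \<delta>(1,2) \<open>r' > 0\<close>
    by (intro exI[of _ \<delta>] conjI exI[of _ "K + 1"] exI[of _ r']) auto
qed

section \<open>Normalized flows and existence of equilibria\<close>

abbreviation "\<psi> \<equiv> edge_inv E (weight_matrix E Y V) (incidence_pinv E P')"

text \<open>On the edge space the pseudoinverse undoes the incidence matrix, and the inverse of the
  weight matrix then undoes the scaling.\<close>

lemma flow_solution_unique:
  assumes "f \<in> edge_space E" "incidence E *v (\<chi> e. weights $ e * f $ e) = P'"
  shows "\<psi> = f"
proof -
  have "(\<chi> e. weights $ e * f $ e) \<in> edge_space E"
    by (simp add: edge_space_def weights_outside)
  from incidence_pinv_incidence[OF asym acyclic this]
  have "incidence_pinv E P' = (\<chi> e. weights $ e * f $ e)" by (simp add: assms(2))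
  then show ?thesis by (simp add: edge_inv_weight_matrix[OF weights_pos assms(1)])
qed

lemma flow_solution_exists: "\<psi> \<in> edge_space E" "incidence E *v (\<chi> e. weights $ e * \<psi> $ e) = P'"
proof -
  obtain g where g: "g \<in> edge_space E" "incidence E *v g = P'"
    using balanced_imp_incidence_range[OF asym connected sum_shift_eq_0] by blast
  \<comment> \<open>Outside \<open>E\<close> this is \<open>0 / 0 = 0\<close>, so \<open>f\<close>
    stays in the edge space.\<close>
  define f where "f = (\<chi> e. g $ e / weights $ e)"
  have "f \<in> edge_space E" using g(1) by (auto simp: f_def edge_space_def)
  have "weights $ e * f $ e = g $ e" for e
    using weights_pos[of e] edge_space_nth[OF g(1), of e] by (cases "e \<in> E") (auto simp: f_def)
  then have "(\<chi> e. weights $ e * f $ e) = g" by (simp add: vec_eq_iff)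
  then have "incidence E *v (\<chi> e. weights $ e * f $ e) = P'" by (simp add: g(2))
  with flow_solution_unique[OF \<open>f \<in> edge_space E\<close>] \<open>f \<in> edge_space E\<close>
  show "\<psi> \<in> edge_space E" "incidence E *v (\<chi> e. weights $ e * \<psi> $ e) = P'" by auto
qed

lemma vec_sin_in_edge_space: "x \<in> edge_space E \<Longrightarrow> vec_sin x \<in> edge_space E"
  unfolding edge_space_def vec_sin_def by simp

lemma power_flow_iff: "P_e Y V \<theta> = P' \<longleftrightarrow> vec_sin (flow.tension \<theta>) = \<psi>"
proof -
  have eq: "P_e Y V \<theta> = incidence E *v (\<chi> e. weights $ e * vec_sin (flow.tension \<theta>) $ e)"
    by (simp add: injection_eq_P_e[symmetric] flow.injection_def vec_sin_def)
  have edge: "vec_sin (flow.tension \<theta>) \<in> edge_space E"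
    unfolding flow.tension_def by (intro vec_sin_in_edge_space transpose_incidence_in_edge_space)
  show ?thesis
  proof
    assume "P_e Y V \<theta> = P'"
    then show "vec_sin (flow.tension \<theta>) = \<psi>"
      using flow_solution_unique[OF edge] unfolding eq by simp
  next
    assume "vec_sin (flow.tension \<theta>) = \<psi>"
    then show "P_e Y V \<theta> = P'"
      unfolding eq using flow_solution_exists(2) by simp
  qed
qed

lemma equilibrium_orbit:
  assumes "\<theta> \<in> arc_set E \<gamma>" "\<gamma> < pi / 2" "P_e Y V \<theta> = P'"
  shows "orbit \<theta> = {\<phi> \<in> arc_set E \<gamma>. P_e Y V \<phi> = P'}"
proof safe
  fix \<phi> assume "\<phi> \<in> orbit \<theta>"
  then show "\<phi> \<in> arc_set E \<gamma>" by (rule orbit_arc_set[OF _ assms(1)])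
  show "P_e Y V \<phi> = P'" using P_e_orbit[OF \<open>\<phi> \<in> orbit \<theta>\<close>] assms(3) by simp
next
  fix \<phi> assume \<phi>: "\<phi> \<in> arc_set E \<gamma>" "P_e Y V \<phi> = P'"
  then have eq: "vec_sin (flow.tension \<phi>) = vec_sin (flow.tension \<theta>)"
    using assms(3) unfolding power_flow_iff by simp
  show "\<phi> \<in> orbit \<theta>"
  proof (rule orbit_of_equal_sines[OF connected assms(2,1) \<phi>(1)])
    fix i j assume "(i, j) \<in> E"
    then show "sin (\<phi> $ i - \<phi> $ j) = sin (\<theta> $ i - \<theta> $ j)"
      using arg_cong[OF eq, of "\<lambda>x. x $ (i, j)"] by (simp add: vec_sin_def tension_nth)
  qed
qed

text \<open>Arcs shorter than a quarter turn keep each cosine positive, hence each squared sine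
  below 1, and the sines are the entries of \<open>\<psi>\<close>.\<close>

lemma infnorm_less_of_equilibrium:
  assumes "\<theta> \<in> arc_set E \<gamma>" "\<gamma> < pi / 2" "P_e Y V \<theta> = P'"
  shows "infnorm \<psi> < 1"
  unfolding infnorm_less_iff
proof
  fix e :: "'n \<times> 'n"
  obtain i j where e: "e = (i, j)" by (cases e)
  show "\<bar>\<psi> $ e\<bar> < 1"
  proof (cases "e \<in> E")
    case False
    then show ?thesis using edge_space_nth[OF flow_solution_exists(1)] by simp
  next
    case True
    then have "circle_dist (\<theta> $ i) (\<theta> $ j) < pi / 2"
      using assms(1,2) e by (fastforce simp: arc_set_def)
    then obtain m :: int where "\<bar>\<theta> $ i - \<theta> $ j + 2 * pi * of_int m\<bar> < pi / 2"
      by (rule circle_dist_lessE)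
    then have "cos (\<theta> $ i - \<theta> $ j + 2 * pi * of_int m) > 0"
      by (intro cos_gt_zero_pi) linarith+
    then have "cos (\<theta> $ i - \<theta> $ j) > 0" unfolding cos_add_int_2pi .
    then have "(sin (\<theta> $ i - \<theta> $ j))\<^sup>2 < 1"
      using sin_cos_squared_add[of "\<theta> $ i - \<theta> $ j"] by (smt (verit) zero_less_power)
    then have "\<bar>sin (\<theta> $ i - \<theta> $ j)\<bar> < 1" by (simp add: abs_square_less_1)
    moreover have "\<psi> = vec_sin (flow.tension \<theta>)"
      using assms(3) unfolding power_flow_iff by simp
    then have "\<psi> $ e = sin (\<theta> $ i - \<theta> $ j)"
      using True e by (simp add: vec_sin_def tension_nth)
    ultimately show ?thesis by simp
  qed
qed

text \<open>The arcsines of the normalized flows are prescribed as edge differences, which is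
  possible on an acyclic graph. Finitely many values below a quarter turn have a maximum below
  it.\<close>

lemma equilibrium_of_infnorm_less:
  assumes "infnorm \<psi> < 1"
  obtains \<gamma> \<theta> where "0 \<le> \<gamma>" "\<gamma> < pi / 2" "P_e Y V \<theta> = P'"
    "\<And>i j. (i, j) \<in> E \<Longrightarrow> \<bar>\<theta> $ i - \<theta> $ j\<bar> \<le> \<gamma>"
proof -
  have less: "\<bar>\<psi> $ e\<bar> < 1" for e using assms infnorm_less_iff by blast
  define x where "x = (\<chi> e. arcsin (\<psi> $ e))"
  have "x \<in> edge_space E"
    using flow_solution_exists(1) unfolding x_def edge_space_def by simp
  then obtain \<theta> where \<theta>: "flow.tension \<theta> = x"
    unfolding flow.tension_def using transpose_incidence_surj[OF asym acyclic] by blast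
  have "vec_sin x = \<psi>"
    using less by (simp add: vec_sin_def x_def vec_eq_iff abs_less_iff less_imp_le minus_le_iff)
  then have eq: "P_e Y V \<theta> = P'" by (simp add: power_flow_iff \<theta>)
  \<comment> \<open>The maximum runs over all ordered pairs, so it exists and is nonnegative even
    without edges.\<close>
  define \<gamma> where "\<gamma> = Max (range (\<lambda>e. \<bar>x $ e\<bar>))"
  have le: "\<bar>x $ e\<bar> \<le> \<gamma>" for e unfolding \<gamma>_def by (rule Max_ge) auto
  have "\<bar>x $ e\<bar> < pi / 2" for e
  proof -
    have "- (pi / 2) < arcsin (\<psi> $ e)" "arcsin (\<psi> $ e) < pi / 2"
      using arcsin_lt_bounded[of "\<psi> $ e"] less[of e] by linarith+
    then show ?thesis unfolding x_def vec_lambda_beta by linarith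
  qed
  then have "\<gamma> < pi / 2" unfolding \<gamma>_def by (subst Max_less_iff) auto
  moreover have "0 \<le> \<gamma>" using order_trans[OF abs_ge_zero le] .
  moreover have "\<bar>\<theta> $ i - \<theta> $ j\<bar> \<le> \<gamma>" if "(i, j) \<in> E" for i j
    using le[of "(i, j)"] that by (simp add: tension_nth flip: \<theta>)
  ultimately show ?thesis using that eq by blast
qed

lemma stable_unique_equilibriumI:
  assumes "0 \<le> \<gamma>" "\<gamma> < pi / 2" and P_e: "P_e Y V \<theta> = P'"
    and arc: "\<And>i j. (i, j) \<in> E \<Longrightarrow> \<bar>\<theta> $ i - \<theta> $ j\<bar> \<le> \<gamma>"
  shows "stable_unique_equilibrium_manifold E V\<^sub>L V\<^sub>I Y V D k P \<gamma> \<theta> p_sync"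
proof -
  have "circle_dist (\<theta> $ i) (\<theta> $ j) \<le> \<gamma>" if "(i, j) \<in> E" for i j
    by (rule order_trans[OF circle_dist_le arc[OF that]])
  then have "\<theta> \<in> arc_set E \<gamma>"
    by (auto simp: arc_set_def)
  then show ?thesis
    using equilibrium_orbit[OF _ assms(2) P_e] locally_exponentially_stable_orbit[OF P_e assms(1,2) arc] P_e
    unfolding stable_unique_equilibrium_manifold_def equilibrium_iff by blast
qed

end

theorem mainTheorem2:
  fixes E :: "('n::finite \<times> 'n) set" and V\<^sub>L V\<^sub>I :: "'n set"
    and Y :: "complex ^ 'n ^ 'n" and z :: "'n set \<Rightarrow> complex"
    and V D Pbar :: "'n \<Rightarrow> real" and P P' :: "real ^ 'n" and k :: real
    and \<xi> \<psi> :: "real ^ ('n \<times> 'n)"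
  assumes graph: "asym E" "connected_graph E" "acyclic_graph E"
    and partition: "V\<^sub>L \<union> V\<^sub>I = UNIV" "V\<^sub>L \<inter> V\<^sub>I = {}" "V\<^sub>I \<noteq> {}"
    and lines: "\<And>i j. adjacent E i j \<Longrightarrow>
        Re (Y $ i $ j) = 0 \<and> Im (Y $ i $ j) = 1 / cmod (z {i, j}) \<and> Im (Y $ i $ j) > 0"
    and no_line: "\<And>i j. i \<noteq> j \<Longrightarrow> \<not> adjacent E i j \<Longrightarrow> Y $ i $ j = 0"
    and voltages: "\<And>i. V i > 0"
    and ratings: "\<And>i. i \<in> V\<^sub>I \<Longrightarrow> Pbar i \<ge> 0"
    and load_balance: "0 \<le> - (\<Sum>i\<in>V\<^sub>L. P $ i)" "- (\<Sum>i\<in>V\<^sub>L. P $ i) \<le> (\<Sum>i\<in>V\<^sub>I. Pbar i)"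
    and setpoints: "\<And>i. i \<in> V\<^sub>I \<Longrightarrow> P $ i \<in> {0..Pbar i}"
    and droop_coefficients: "\<And>i. i \<in> V\<^sub>I \<Longrightarrow> D i > 0"
    and gain: "k > 0"
    and shifted_injections: "P' = P_shift V\<^sub>I D P"
    and flows: "\<xi> = incidence_pinv E P'"
    and normalized_flows: "\<psi> = edge_inv E (weight_matrix E Y V) \<xi>"
  shows
    "(infnorm \<psi> < 1 \<longleftrightarrow>
       (\<exists>\<gamma>\<in>{0..<pi/2}. \<exists>\<theta> p. stable_unique_equilibrium_manifold E V\<^sub>L V\<^sub>I Y V D k P \<gamma> \<theta> p)) \<and>
     (\<forall>\<gamma>\<in>{0..<pi/2}. \<forall>\<theta> p. stable_unique_equilibrium_manifold E V\<^sub>L V\<^sub>I Y V D k P \<gamma> \<theta> p \<longrightarrow>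
       orbit \<theta> = {\<phi> \<in> arc_set E \<gamma>. droop_equilibrium V\<^sub>L V\<^sub>I Y V D P' \<phi>} \<and>
       vec_sin (transpose (incidence E) *v \<theta>) = \<psi> \<and>
       P_e Y V \<theta> = P' \<and>
       (\<forall>i\<in>V\<^sub>I. p $ i = D i * \<omega>_sync V\<^sub>I D P))"
proof -
  interpret microgrid E V\<^sub>L V\<^sub>I Y V D P k
  proof
    fix i j assume "(i, j) \<in> E"
    then have "adjacent E i j" "adjacent E j i" by (auto simp: adjacent_def)
    then show "Im (Y $ j $ i) = Im (Y $ i $ j)" "Im (Y $ i $ j) > 0"
      using lines[of i j] lines[of j i] by (metis insert_commute, blast)
  next
    show "V\<^sub>L = - V\<^sub>I" using partition(1,2) by blast
  qed (fact graph partition(3) voltages gain | rule no_line droop_coefficients; assumption)+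
  have \<psi>: "\<psi> = edge_inv E (weight_matrix E Y V) (incidence_pinv E (P_shift V\<^sub>I D P))"
    by (simp add: normalized_flows flows shifted_injections)
  have manifold: "\<theta> \<in> arc_set E \<gamma> \<and> P_e Y V \<theta> = P_shift V\<^sub>I D P \<and> p = sync_input V\<^sub>I D P"
    if "stable_unique_equilibrium_manifold E V\<^sub>L V\<^sub>I Y V D k P \<gamma> \<theta> p" for \<gamma> \<theta> p
    using that by (simp add: stable_unique_equilibrium_manifold_def equilibrium_iff)
  show ?thesis
    unfolding \<psi> shifted_injections droop_equilibrium_iff
  proof (intro conjI iffI ballI allI impI)
    assume "infnorm (edge_inv E (weight_matrix E Y V) (incidence_pinv E (P_shift V\<^sub>I D P))) < 1"
    then obtain \<gamma> \<theta> where "0 \<le> \<gamma>" "\<gamma> < pi / 2" "P_e Y V \<theta> = P_shift V\<^sub>I D P"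
      "\<And>i j. (i, j) \<in> E \<Longrightarrow> \<bar>\<theta> $ i - \<theta> $ j\<bar> \<le> \<gamma>"
      using equilibrium_of_infnorm_less by blast
    from stable_unique_equilibriumI[OF this] have
      "\<exists>\<theta> p. stable_unique_equilibrium_manifold E V\<^sub>L V\<^sub>I Y V D k P \<gamma> \<theta> p" by blast
    with \<open>0 \<le> \<gamma>\<close> \<open>\<gamma> < pi / 2\<close> show "\<exists>\<gamma>\<in>{0..<pi/2}. \<exists>\<theta> p. stable_unique_equilibrium_manifold E V\<^sub>L V\<^sub>I Y V D k P \<gamma> \<theta> p"
      by (intro bexI[of _ \<gamma>]) auto
  next
    assume "\<exists>\<gamma>\<in>{0..<pi/2}. \<exists>\<theta> p. stable_unique_equilibrium_manifold E V\<^sub>L V\<^sub>I Y V D k P \<gamma> \<theta> p"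
    then obtain \<gamma> \<theta> p where "\<gamma> < pi / 2"
      and "stable_unique_equilibrium_manifold E V\<^sub>L V\<^sub>I Y V D k P \<gamma> \<theta> p" by auto
    with manifold[OF this(2)]
    show "infnorm (edge_inv E (weight_matrix E Y V) (incidence_pinv E (P_shift V\<^sub>I D P))) < 1"
      by (intro infnorm_less_of_equilibrium) blast+
  next
    fix \<gamma> \<theta> p
    assume \<gamma>: "\<gamma> \<in> {0..<pi/2}"
      and "stable_unique_equilibrium_manifold E V\<^sub>L V\<^sub>I Y V D k P \<gamma> \<theta> p"
    from manifold[OF this(2)] have \<theta>: "\<theta> \<in> arc_set E \<gamma>" "P_e Y V \<theta> = P_shift V\<^sub>I D P"
      and p: "p = sync_input V\<^sub>I D P" by auto
    show "orbit \<theta> = {\<phi> \<in> arc_set E \<gamma>. P_e Y V \<phi> = P_shift V\<^sub>I D P}"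
      using \<gamma> by (intro equilibrium_orbit \<theta>) auto
    show "vec_sin (transpose (incidence E) *v \<theta>)
        = edge_inv E (weight_matrix E Y V) (incidence_pinv E (P_shift V\<^sub>I D P))"
      using \<theta>(2) unfolding power_flow_iff flow.tension_def .
    show "P_e Y V \<theta> = P_shift V\<^sub>I D P" by fact
    show "p $ i = D i * \<omega>_sync V\<^sub>I D P" if "i \<in> V\<^sub>I" for i
      using that by (simp add: p sync_input_def)
  qed
qed

end
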